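(* Given an integer $n\ge1$, the zeros $\tau_1,\dots,\tau_n$ of the Legendre polynomial $P_n$, and $t\in(-1,1)$, all the values $F^n_0(t),F^n_1(t),\dots,F^n_n(t)$ of the Gauss--Legendre polynomials can be evaluated in $O(n^2)$ time by applying the Clenshaw algorithm to either of the following two families of representations (the cost including the computation of the coefficients). (A) For $1\le i\le n-1$, $F^n_i(t)=\frac{1}{2}(P_{n-1}(\tau_i)-P_{n-1}(\tau_{i+1}))P_n(t)+\frac{1}{2}\sum_{k=0}^{n-1}(R_{k}(\tau_{i+1})-R_{k}(\tau_i))P_k(t)$, and $F^n_0(t)=\frac{1}{2}-\frac{1}{2}P_{n-1}(\tau_1)P_n(t)+\frac{1}{2}\sum_{k=0}^{n-1}R_{k}(\tau_1)P_k(t)$, $F^n_n(t)=\frac{1}{2}+\frac{1}{2}P_{n-1}(\tau_n)P_n(t)-\frac{1}{2}\sum_{k=0}^{n-1}R_{k}(\tau_n)P_k(t)$. (B) For $1\le i\le n-1$, $F^n_i(t)=\frac{1}{2}(t^2-1)\sum_{k=1}^{n-1}\frac{2k+1}{2k}(P_k(\tau_i)-P_k(\tau_{i+1}))P^{(1)}_{k-1}(t)$, and $F^n_0(t)=1-\frac{1}{2}(t+1)\bigl(1+(t-1)\sum_{k=1}^{n-1}\frac{2k+1}{2k}P_k(\tau_1)P^{(1)}_{k-1}(t)\bigr)$, $F^n_n(t)=\frac{1}{2}(t+1)\bigl(1+(t-1)\sum_{k=1}^{n-1}\frac{2k+1}{2k}P_k(\tau_n)P^{(1)}_{k-1}(t)\bigr)$.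 Consequently, for every $d\ge1$ and all control points $W_0,\dots,W_n\in\mathbb E^d$, the point $\sum_{i=0}^n W_iF^n_i(t)$ of the Gauss--Legendre curve of degree $n$ can be evaluated component-wise with computational complexity $O(n^2+dn)$.
   Context: Time/computational complexity means the number of real arithmetic operations, with implied constants independent of $n,d,t$ and the control points; the zeros of $P_n$ are assumed to be known (precomputed). For $\alpha>-1$, $P^{(\alpha)}_k:=P^{(\alpha,\alpha)}_k$ is the symmetric Jacobi polynomial of degree $k$: orthogonal on $[-1,1]$ with respect to $(1-x^2)^\alpha$, normalized by $P^{(\alpha)}_k(1)=\binom{k+\alpha}{k}$. $P_k:=P^{(0)}_k$ is the Legendre polynomial, $P_{-1}\equiv0$, and $R_k(t):=P_{k+1}(t)-P_{k-1}(t)$ for $k\ge0$. The zeros of $P_n$ are $-1<\tau_1<\cdots<\tau_n<1$. $\mathbb E^d$ is $d$-dimensional Euclidean space. Clenshaw algorithm: to evaluate $u(x)=\sum_{k=0}^m v_kP^{(\alpha)}_k(x)$, set $B_{m+1}=B_{m+2}:=0$, and for $k=m,m-1,\dots,0$ set $B_k:=v_k+x\,\xi^{(\alpha)}_1(k+1)B_{k+1}-\xi^{(\alpha)}_2(k+2)B_{k+2}$, where $\xi^{(\alpha)}_1(k):=\frac{(k+\alpha)(2k+2\alpha-1)}{k(k+2\alpha)}$ $(k\ge1)$ and $\xi^{(\alpha)}_2(k):=\frac{(k+\alpha-1)(k+\alpha)}{k(k+2\alpha)}$ $(k\ge2)$; then $u(x)=B_0$. Gauss--Legendre polynomials: set $G^n_0(t)\equiv\frac12$,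 $G^n_{n+1}(t)\equiv-\frac12$, and for $i=1,\dots,n$ $$G^n_i(t):=\frac{nP_{n-1}(\tau_i)}{2}\int_{-1}^{t}\frac{P_n(x)}{x-\tau_i}\,dx-\frac12 ,$$ where $P_n(x)/(x-\tau_i)$ is regarded as a polynomial. Then $F^n_i(t):=G^n_i(t)-G^n_{i+1}(t)$ for $i=0,1,\dots,n$. The Gauss--Legendre curve of degree $n$ with control points $W_0,\dots,W_n\in\mathbb E^d$ is $t\mapsto\sum_{i=0}^nW_iF^n_i(t)$, $t\in[-1,1]$. *)

theory Defs
  imports "HOL-Analysis.Analysis" "HOL-Computational_Algebra.Polynomial"
begin

text \<open>Orthogonality is stated with \<^const>\<open>has_integral\<close>, so that it includes the existence of the
  integral. At the endpoints the weight is \<^term>\<open>0 powr \<alpha> = 0\<close>, which does not affect it.\<close>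

definition is_sym_jacobi :: "real \<Rightarrow> (nat \<Rightarrow> real poly) \<Rightarrow> bool" where
  "is_sym_jacobi \<alpha> P \<longleftrightarrow>
     (\<forall>k. degree (P k) = k) \<and>
     (\<forall>j k. j \<noteq> k \<longrightarrow>
        ((\<lambda>x. (1 - x\<^sup>2) powr \<alpha> * poly (P j) x * poly (P k) x) has_integral 0) {-1..1}) \<and>
     (\<forall>k. poly (P k) 1 = (real k + \<alpha>) gchoose k)"

definition sym_jacobi :: "real \<Rightarrow> nat \<Rightarrow> real poly" where
  "sym_jacobi \<alpha> = (THE P. is_sym_jacobi \<alpha> P)"

abbreviation legendre :: "nat \<Rightarrow> real poly" where
  "legendre \<equiv> sym_jacobi 0"

text \<open>The case distinction implements the convention that the Legendre polynomial of index
  \<open>-1\<close> is zero.\<close>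

definition legendre_diff :: "nat \<Rightarrow> real poly" where
  "legendre_diff k = legendre (k + 1) - (if k = 0 then 0 else legendre (k - 1))"

text \<open>The zeros of the Legendre polynomial of degree \<open>n\<close> in increasing order, numbered
  from \<open>1\<close> to \<open>n\<close>.\<close>

definition gl_node :: "nat \<Rightarrow> nat \<Rightarrow> real" where
  "gl_node n i = sorted_list_of_set {x. poly (legendre n) x = 0} ! (i - 1)"

definition gl_G :: "nat \<Rightarrow> nat \<Rightarrow> real \<Rightarrow> real" where
  "gl_G n i t =
     (if i = 0 then 1/2
      else if i = n + 1 then - 1/2
      else real n * poly (legendre (n - 1)) (gl_node n i) / 2 *
             integral {-1..t} (\<lambda>x. poly (legendre n div [:- gl_node n i, 1:]) x) - 1/2)"

definition gl_F :: "nat \<Rightarrow> nat \<Rightarrow> real \<Rightarrow> real" where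
  "gl_F n i t = gl_G n i t - gl_G n (i + 1) t"

definition gl_curve :: "nat \<Rightarrow> (nat \<Rightarrow> 'a::real_vector) \<Rightarrow> real \<Rightarrow> 'a" where
  "gl_curve n W t = (\<Sum>i=0..n. gl_F n i t *\<^sub>R W i)"

text \<open>A program is a list of assignments whose right-hand sides are arithmetic expressions.
  The assignments depend on the dimensions only, never on the data stored in the memory. The
  only constants are natural numbers (loop indices and the like), and the cost is the number of
  arithmetic operations on reals that are performed. The only denominators in the programs below
  are nonzero expressions in constants.\<close>

datatype var =
    Param           \<comment> \<open>input: the argument \<open>t\<close>\<close>
  | Node nat        \<comment> \<open>input: the zeros\<close>
  | Ctrl nat nat    \<comment> \<open>input: \<open>Ctrl i j\<close> is the \<open>j\<close>-th component of the \<open>i\<close>-th control point\<close>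
  | LegAt nat nat   \<comment> \<open>\<open>LegAt k i\<close> is the \<open>k\<close>-th Legendre polynomial at the \<open>i\<close>-th zero\<close>
  | Coef nat        \<comment> \<open>the coefficients passed to the Clenshaw algorithm\<close>
  | Clen nat        \<comment> \<open>the quantities \<open>B\<^sub>k\<close> of the Clenshaw algorithm\<close>
  | FVal nat        \<comment> \<open>output: the values of the Gauss--Legendre polynomials\<close>
  | Point nat       \<comment> \<open>output: the components of the point on the curve\<close>

datatype aexp =
    Num nat
  | Var var
  | Add aexp aexp (infixl "\<oplus>" 65)
  | Sub aexp aexp (infixl "\<ominus>" 65)
  | Mul aexp aexp (infixl "\<otimes>" 70)
  | Div aexp aexp (infixl "\<oslash>" 70)

datatype instr = Assign var aexp (infix "::=" 55)

fun aval :: "aexp \<Rightarrow> (var \<Rightarrow> real) \<Rightarrow> real" where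
  "aval (Num k) m = real k"
| "aval (Var x) m = m x"
| "aval (a \<oplus> b) m = aval a m + aval b m"
| "aval (a \<ominus> b) m = aval a m - aval b m"
| "aval (a \<otimes> b) m = aval a m * aval b m"
| "aval (a \<oslash> b) m = aval a m / aval b m"

fun exec :: "instr list \<Rightarrow> (var \<Rightarrow> real) \<Rightarrow> (var \<Rightarrow> real)" where
  "exec [] m = m"
| "exec ((x ::= a) # p) m = exec p (m(x := aval a m))"

fun ops :: "aexp \<Rightarrow> nat" where
  "ops (Num k) = 0"
| "ops (Var x) = 0"
| "ops (a \<oplus> b) = ops a + ops b + 1"
| "ops (a \<ominus> b) = ops a + ops b + 1"
| "ops (a \<otimes> b) = ops a + ops b + 1"
| "ops (a \<oslash> b) = ops a + ops b + 1"

fun cost :: "instr list \<Rightarrow> nat" where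
  "cost [] = 0"
| "cost ((x ::= a) # p) = ops a + cost p"

definition xi1 :: "aexp \<Rightarrow> nat \<Rightarrow> aexp" where
  "xi1 \<alpha> k = ((Num k \<oplus> \<alpha>) \<otimes> (Num 2 \<otimes> Num k \<oplus> Num 2 \<otimes> \<alpha> \<ominus> Num 1)) \<oslash>
             (Num k \<otimes> (Num k \<oplus> Num 2 \<otimes> \<alpha>))"

definition xi2 :: "aexp \<Rightarrow> nat \<Rightarrow> aexp" where
  "xi2 \<alpha> k = ((Num k \<oplus> \<alpha> \<ominus> Num 1) \<otimes> (Num k \<oplus> \<alpha>)) \<oslash>
             (Num k \<otimes> (Num k \<oplus> Num 2 \<otimes> \<alpha>))"

text \<open>The Clenshaw algorithm for a sum of \<open>N\<close> terms, with coefficients \<open>Coef 0\<close>, \dots,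
  \<open>Coef (N - 1)\<close>, at the argument \<open>Param\<close>; the result is left in \<open>Clen 0\<close>. The number \<open>N\<close>
  is \<open>m + 1\<close> in terms of the highest index \<open>m\<close>, which makes the empty sum available.\<close>

definition clenshaw :: "aexp \<Rightarrow> nat \<Rightarrow> instr list" where
  "clenshaw \<alpha> N =
     [Clen (N + 1) ::= Num 0, Clen N ::= Num 0] @
     map (\<lambda>k. Clen k ::= Var (Coef k) \<oplus> Var Param \<otimes> xi1 \<alpha> (k + 1) \<otimes> Var (Clen (k + 1))
                       \<ominus> xi2 \<alpha> (k + 2) \<otimes> Var (Clen (k + 2)))
       (rev [0..<N])"

text \<open>The values at the zeros of the Legendre polynomials of degree at most \<open>n\<close>, by the
  three-term recurrence \<open>(k + 1) P\<^sub>k\<^sub>+\<^sub>1 = (2 k + 1) x P\<^sub>k - k P\<^sub>k\<^sub>-\<^sub>1\<close>.\<close>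

definition tabulate :: "nat \<Rightarrow> instr list" where
  "tabulate n = concat (map (\<lambda>i.
     [LegAt 0 i ::= Num 1, LegAt 1 i ::= Var (Node i)] @
     map (\<lambda>k. LegAt (k + 1) i ::=
            ((Num 2 \<otimes> Num k \<oplus> Num 1) \<otimes> Var (Node i) \<otimes> Var (LegAt k i)
               \<ominus> Num k \<otimes> Var (LegAt (k - 1) i)) \<oslash> (Num k \<oplus> Num 1))
       [1..<n]) [1..<n + 1])"

definition half :: aexp where
  "half = Num 1 \<oslash> Num 2"

definition diff_at :: "nat \<Rightarrow> nat \<Rightarrow> aexp" where
  "diff_at k i = Var (LegAt (k + 1) i) \<ominus> (if k = 0 then Num 0 else Var (LegAt (k - 1) i))"

text \<open>In the first family of representations the additive constant \<open>1/2\<close> that occurs for the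
  first and the last index is not part of the Legendre sum; it is added after the Clenshaw
  algorithm.\<close>

definition coefs_A :: "nat \<Rightarrow> nat \<Rightarrow> instr list" where
  "coefs_A n i =
     (if i = 0 then
        map (\<lambda>k. Coef k ::= half \<otimes> diff_at k 1) [0..<n] @
        [Coef n ::= Num 0 \<ominus> half \<otimes> Var (LegAt (n - 1) 1)]
      else if i = n then
        map (\<lambda>k. Coef k ::= Num 0 \<ominus> half \<otimes> diff_at k n) [0..<n] @
        [Coef n ::= half \<otimes> Var (LegAt (n - 1) n)]
      else
        map (\<lambda>k. Coef k ::= half \<otimes> (diff_at k (i + 1) \<ominus> diff_at k i)) [0..<n] @
        [Coef n ::= half \<otimes> (Var (LegAt (n - 1) i) \<ominus> Var (LegAt (n - 1) (i + 1)))])"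

definition result_A :: "nat \<Rightarrow> nat \<Rightarrow> aexp" where
  "result_A n i = (if i = 0 \<or> i = n then half \<oplus> Var (Clen 0) else Var (Clen 0))"

definition eval_A :: "nat \<Rightarrow> instr list" where
  "eval_A n = tabulate n @
     concat (map (\<lambda>i. coefs_A n i @ clenshaw (Num 0) (n + 1) @ [FVal i ::= result_A n i])
       [0..<n + 1])"

text \<open>In the second family of representations the coefficient with index \<open>k\<close> in the formula belongs to the
  Jacobi polynomial of degree \<open>k - 1\<close>, and the sum has \<open>n - 1\<close> terms.\<close>

definition coefs_B :: "nat \<Rightarrow> nat \<Rightarrow> instr list" where
  "coefs_B n i =
     map (\<lambda>k. Coef (k - 1) ::= (Num 2 \<otimes> Num k \<oplus> Num 1) \<oslash> (Num 2 \<otimes> Num k) \<otimes>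
            (if i = 0 then Var (LegAt k 1)
             else if i = n then Var (LegAt k n)
             else Var (LegAt k i) \<ominus> Var (LegAt k (i + 1))))
       [1..<n]"

definition end_B :: aexp where
  "end_B = half \<otimes> (Var Param \<oplus> Num 1) \<otimes>
             (Num 1 \<oplus> (Var Param \<ominus> Num 1) \<otimes> Var (Clen 0))"

definition result_B :: "nat \<Rightarrow> nat \<Rightarrow> aexp" where
  "result_B n i =
     (if i = 0 then Num 1 \<ominus> end_B
      else if i = n then end_B
      else half \<otimes> (Var Param \<otimes> Var Param \<ominus> Num 1) \<otimes> Var (Clen 0))"

definition eval_B :: "nat \<Rightarrow> instr list" where
  "eval_B n = tabulate n @
     concat (map (\<lambda>i. coefs_B n i @ clenshaw (Num 1) (n - 1) @ [FVal i ::= result_B n i])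
       [0..<n + 1])"

definition combine :: "nat \<Rightarrow> nat \<Rightarrow> instr list" where
  "combine n d = concat (map (\<lambda>j.
     (Point j ::= Num 0) #
     map (\<lambda>i. Point j ::= Var (Point j) \<oplus> Var (Ctrl i j) \<otimes> Var (FVal i)) [0..<n + 1])
     [0..<d])"

end

theory Submission
  imports Defs
begin

text \<open>Write \<open>P\<^sub>k\<close> for the Legendre polynomials, \<open>R\<^sub>k = P\<^sub>k\<^sub>+\<^sub>1 - P\<^sub>k\<^sub>-\<^sub>1\<close>, and let \<open>\<tau>\<close> be a zero of \<open>P\<^sub>n\<close>.
  Everything rests on one formula for the functions \<open>G\<^sub>i\<close>. By the Christoffel--Darboux identity,
  \<open>n P\<^sub>n\<^sub>-\<^sub>1(\<tau>) P\<^sub>n(x) / (x - \<tau>)\<close> is the sum of \<open>(2 k + 1) P\<^sub>k(\<tau>) P\<^sub>k(x)\<close> over \<open>k < n\<close>. Since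
  \<open>(2 k + 1) P\<^sub>k\<close> is the derivative of \<open>R\<^sub>k\<close>, and \<open>R\<^sub>k\<close> vanishes at \<open>-1\<close> except for \<open>R\<^sub>0(-1) = -1\<close>,
  integration shows that \<open>G\<^sub>i(t)\<close> is half the sum of \<open>P\<^sub>k(\<tau>\<^sub>i) R\<^sub>k(t)\<close> over \<open>k < n\<close>
  (\<open>gl_G_eq_sum_legendre_diff\<close>).

  The two families of representations are two ways to read this sum. Summation by parts moves
  the differences from \<open>t\<close> to \<open>\<tau>\<^sub>i\<close>, and the boundary term simplifies because \<open>P\<^sub>n(\<tau>\<^sub>i) = 0\<close>; this gives
  the Legendre sums. Alternatively, for \<open>k \<ge> 1\<close> the polynomial \<open>R\<^sub>k(t)\<close> is a multiple of
  \<open>(t\<^sup>2 - 1) P\<^sub>k'(t)\<close>, and \<open>P\<^sub>k'\<close> is a multiple of the Jacobi polynomial of degree \<open>k - 1\<close> for the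
  weight \<open>1 - x\<^sup>2\<close>; this gives the other family.

  The polynomials are specified by orthogonality, so they are first identified with explicit
  ones: \<open>is_sym_jacobi_unique\<close> shows that the specification determines them, and the sequence
  defined by the three-term recurrence (for the other weight, the sequence of its scaled
  derivatives) satisfies it. Orthogonality also yields that \<open>P\<^sub>n\<close> has \<open>n\<close> distinct zeros
  (\<open>card_roots_sym_jacobi\<close>), without which the nodes would not be meaningful.

  The programs are correct because the Clenshaw algorithm evaluates a sum for any sequence that
  starts with \<open>1\<close> and satisfies the three-term recurrence with the coefficients \<open>\<xi>\<^sub>1\<close>, \<open>\<xi>\<^sub>2\<close>, which both
  sequences do. The operation counts are linear in \<open>n\<close> for each of the \<open>n\<close> columns of
  the table of values \<open>P\<^sub>k(\<tau>\<^sub>i)\<close> and for each of the \<open>n + 1\<close> output values, and linear in \<open>n\<close> for each of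
  the \<open>d\<close> components of the point on the curve.\<close>

section \<open>Orthogonal polynomials for a symmetric Jacobi weight\<close>

text \<open>A nonnegative continuous function with integral \<open>0\<close> vanishes. The weight need not be
  continuous at the endpoints, so this is applied on a smaller interval; since that interval is
  infinite, the polynomial must be zero.\<close>

lemma weighted_integral_nonneg_poly_eq_0_imp:
  fixes p :: "real poly"
  assumes int: "((\<lambda>x. (1 - x\<^sup>2) powr \<alpha> * poly p x) has_integral 0) {-1..1}"
    and nonneg: "\<And>x. 0 \<le> poly p x"
  shows "p = 0"
proof (rule ccontr)
  assume "p \<noteq> 0"
  let ?f = "\<lambda>x. (1 - x\<^sup>2) powr \<alpha> * poly p x"
  have weight: "0 < 1 - x\<^sup>2" if "x \<in> {-1/2..1/2}" for x :: real
  proof -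
    have "\<bar>x\<bar> < 1" using that by auto
    then show ?thesis by (simp add: abs_square_less_1)
  qed
  have sub: "?f integrable_on {-1/2..1/2}"
    by (rule integrable_on_subinterval[OF has_integral_integrable[OF int]]) auto
  have "integral {-1/2..1/2} ?f \<le> integral {-1..1} ?f"
    using sub int nonneg by (intro integral_subset_le) (auto simp: has_integral_integrable)
  moreover have "0 \<le> integral {-1/2..1/2} ?f"
    using sub nonneg by (intro integral_nonneg) auto
  ultimately have "integral {-1/2..1/2} ?f = 0"
    using int by (simp add: integral_unique)
  then have zero: "(?f has_integral 0) (cbox (-1/2) (1/2))"
    using integrable_integral[OF sub] by simp
  have "continuous_on (cbox (-1/2) (1/2)) ?f"
    using weight by (intro continuous_intros) (auto simp: less_le)
  then have "?f x = 0" if "x \<in> {-1/2..1/2}" for x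
    using that nonneg by (intro has_integral_0_cbox_imp_0[OF _ _ zero]) auto
  then have "{-1/2..1/2} \<subseteq> {x. poly p x = 0}"
    using weight by fastforce
  moreover have "infinite {-1/2..1/2::real}"
    by (simp add: infinite_Icc)
  ultimately show False
    using poly_roots_finite[OF \<open>p \<noteq> 0\<close>] finite_subset by blast
qed

text \<open>Polynomials of degrees \<open>0, 1, \<dots>\<close> span all polynomials: subtracting a multiple of \<open>P j\<close>, where
  \<open>j\<close> is the degree of \<open>q\<close>, lowers the degree.\<close>

lemma sym_jacobi_orthogonal_lower_degree:
  assumes P: "is_sym_jacobi \<alpha> P" and "q = 0 \<or> degree q < k"
  shows "((\<lambda>x. (1 - x\<^sup>2) powr \<alpha> * poly (P k) x * poly q x) has_integral 0) {-1..1}"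
  using assms(2)
proof (induction "degree q" arbitrary: q rule: less_induct)
  case less
  show ?case
  proof (cases "q = 0")
    case False
    define j where "j = degree q"
    define c where "c = lead_coeff q / lead_coeff (P j)"
    define r where "r = q - smult c (P j)"
    have deg: "degree (P j) = j" and j: "j < k"
      using P False less.prems by (auto simp: is_sym_jacobi_def j_def)
    \<comment> \<open>Only \<open>P 0\<close> could be zero without contradicting its degree; its value at \<open>1\<close> excludes this.\<close>
    have "poly (P 0) 1 = 1"
      using P by (simp add: is_sym_jacobi_def)
    then have "P j \<noteq> 0"
      using deg by (cases "j = 0") auto
    then have "coeff (P j) j \<noteq> 0"
      using deg leading_coeff_0_iff[of "P j"] by simp
    then have "coeff r j = 0"
      using deg by (simp add: r_def c_def flip: j_def)
    moreover have "degree r \<le> j"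
      unfolding r_def by (intro degree_diff_le) (auto simp: j_def deg[unfolded j_def])
    ultimately have r: "r = 0 \<or> degree r < j"
      by (rule eq_zero_or_degree_less[rotated])
    have "((\<lambda>x. (1 - x\<^sup>2) powr \<alpha> * poly (P k) x * poly r x) has_integral 0) {-1..1}"
      using r j less.hyps[of r] by (cases "r = 0") (auto simp: j_def)
    moreover have "((\<lambda>x. c * ((1 - x\<^sup>2) powr \<alpha> * poly (P k) x * poly (P j) x))
        has_integral c * 0) {-1..1}"
      using P j by (intro has_integral_mult_right) (auto simp: is_sym_jacobi_def)
    ultimately have "((\<lambda>x. (1 - x\<^sup>2) powr \<alpha> * poly (P k) x * poly r x +
        c * ((1 - x\<^sup>2) powr \<alpha> * poly (P k) x * poly (P j) x)) has_integral 0 + c * 0) {-1..1}"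
      by (rule has_integral_add)
    then show ?thesis
      by (simp add: r_def algebra_simps)
  qed simp
qed

lemma gbinomial_shift_pos:
  fixes \<alpha> :: real
  assumes "\<alpha> > -1"
  shows "(real k + \<alpha>) gchoose k > 0"
  unfolding gbinomial_prod_rev using assms by (intro divide_pos_pos prod_pos) auto

text \<open>If \<open>c\<close> is chosen such that \<open>Q k - c * P k\<close> has degree less than \<open>k\<close>, then this difference is orthogonal
  to both \<open>P k\<close> and \<open>Q k\<close>, hence to itself, hence zero. The common value at \<open>1\<close>, which is nonzero
  for \<open>\<alpha> > -1\<close>, forces \<open>c = 1\<close>.\<close>

lemma is_sym_jacobi_unique:
  assumes P: "is_sym_jacobi \<alpha> P" and Q: "is_sym_jacobi \<alpha> Q" and "\<alpha> > -1"
  shows "P = Q"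
proof
  fix k
  have deg: "degree (P k) = k" "degree (Q k) = k"
    and one: "poly (P k) 1 = (real k + \<alpha>) gchoose k" "poly (Q k) 1 = (real k + \<alpha>) gchoose k"
    using P Q by (auto simp: is_sym_jacobi_def)
  have pos: "(real k + \<alpha>) gchoose k > 0"
    using \<open>\<alpha> > -1\<close> by (rule gbinomial_shift_pos)
  have "P k \<noteq> 0"
    using one(1) pos by auto
  then have lead: "lead_coeff (P k) \<noteq> 0"
    by simp
  define c where "c = lead_coeff (Q k) / lead_coeff (P k)"
  define r where "r = Q k - smult c (P k)"
  have "coeff r k = 0"
    using lead deg by (simp add: r_def c_def)
  moreover have "degree r \<le> k"
    unfolding r_def by (intro degree_diff_le) (auto simp: deg)
  ultimately have r: "r = 0 \<or> degree r < k"
    by (rule eq_zero_or_degree_less[rotated])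
  have "((\<lambda>x. (1 - x\<^sup>2) powr \<alpha> * poly (Q k) x * poly r x -
      c * ((1 - x\<^sup>2) powr \<alpha> * poly (P k) x * poly r x)) has_integral 0 - c * 0) {-1..1}"
    using sym_jacobi_orthogonal_lower_degree[OF Q r] sym_jacobi_orthogonal_lower_degree[OF P r]
    by (intro has_integral_diff has_integral_mult_right)
  then have "((\<lambda>x. (1 - x\<^sup>2) powr \<alpha> * poly (r * r) x) has_integral 0) {-1..1}"
    by (simp add: r_def algebra_simps)
  then have "r * r = 0"
    by (rule weighted_integral_nonneg_poly_eq_0_imp) simp
  then have eq: "Q k = smult c (P k)"
    by (simp add: r_def)
  then have "c = 1"
    using one pos by simp
  then show "P k = Q k"
    using eq by simp
qed

lemma sym_jacobi_eqI:
  assumes "is_sym_jacobi \<alpha> P" "\<alpha> > -1"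
  shows "sym_jacobi \<alpha> = P"
  unfolding sym_jacobi_def using assms is_sym_jacobi_unique by (intro the_equality) auto

text \<open>The set \<open>S\<close> consists of the real roots of odd multiplicity: multiplying by one more factor for
  each of them makes all multiplicities even, and then the sign cannot change. The induction
  splits off one root \<open>a\<close> at a time, which toggles the membership of \<open>a\<close> in \<open>S\<close>.\<close>

lemma ex_roots_fixing_sign:
  fixes p :: "real poly"
  assumes "p \<noteq> 0"
  shows "\<exists>S c. finite S \<and> S \<subseteq> {x. poly p x = 0} \<and> c \<noteq> 0 \<and>
           (\<forall>x. 0 \<le> c * poly p x * (\<Prod>s\<in>S. x - s))"
  using assms
proof (induction "degree p" arbitrary: p rule: less_induct)
  case less
  show ?case
  proof (cases "\<exists>a. poly p a = 0")
    case False
    have "0 \<le> poly p 0 * poly p x" for x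
    proof (rule ccontr)
      assume "\<not> ?thesis"
      then have neg: "poly p 0 * poly p x < 0" by simp
      then have "x \<noteq> 0" by (metis not_square_less_zero)
      then show False
        using poly_IVT[of 0 x p] poly_IVT[of x 0 p] neg False
        by (cases "x < 0") (auto simp: mult.commute)
    qed
    then show ?thesis
      using False by (intro exI[of _ "{}"] exI[of _ "poly p 0"]) auto
  next
    case True
    then obtain a where "poly p a = 0" by blast
    then obtain q where p: "p = [:-a, 1:] * q"
      by (auto simp: poly_eq_0_iff_dvd)
    have "q \<noteq> 0"
      using p less.prems by auto
    then have "degree q < degree p"
      unfolding p by (subst degree_mult_eq) auto
    then obtain S c where S: "finite S" "S \<subseteq> {x. poly q x = 0}" "c \<noteq> 0"
      and nonneg: "\<And>x. 0 \<le> c * poly q x * (\<Prod>s\<in>S. x - s)"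
      using less.hyps[of q] \<open>q \<noteq> 0\<close> by blast
    show ?thesis
    proof (cases "a \<in> S")
      case True
      have eq: "c * poly p x * (\<Prod>s\<in>S - {a}. x - s) = c * poly q x * (\<Prod>s\<in>S. x - s)" for x
        unfolding prod.remove[OF S(1) True] by (simp add: p algebra_simps)
      have "S - {a} \<subseteq> {x. poly p x = 0}"
        using S by (auto simp: p)
      then show ?thesis
        using S nonneg by (intro exI[of _ "S - {a}"] exI[of _ c]) (simp add: eq)
    next
      case False
      have eq: "c * poly p x * (\<Prod>s\<in>insert a S. x - s) =
          (x - a)\<^sup>2 * (c * poly q x * (\<Prod>s\<in>S. x - s))" for x
        using S False by (simp add: p power2_eq_square algebra_simps)
      have "insert a S \<subseteq> {x. poly p x = 0}"
        using S by (auto simp: p)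
      then show ?thesis
        using S nonneg by (intro exI[of _ "insert a S"] exI[of _ c]) (simp add: eq)
    qed
  qed
qed

text \<open>If fewer than \<open>k\<close> roots sufficed to fix the sign of \<open>P k\<close>, the product \<open>q\<close> of the corresponding linear
  factors would have degree less than \<open>k\<close>, so it would be orthogonal to \<open>P k\<close>; but \<open>P k * q\<close>
  has constant sign.\<close>

lemma card_roots_sym_jacobi:
  assumes P: "is_sym_jacobi \<alpha> P" and "\<alpha> > -1"
  shows "card {x. poly (P k) x = 0} = k"
proof (rule antisym)
  have deg: "degree (P k) = k"
    using P by (simp add: is_sym_jacobi_def)
  have nz: "P k \<noteq> 0"
    using P gbinomial_shift_pos[OF \<open>\<alpha> > -1\<close>, of k]
    by (metis is_sym_jacobi_def less_irrefl poly_0)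
  show "card {x. poly (P k) x = 0} \<le> k"
    using card_poly_roots_bound[OF nz] deg by simp
  obtain S c where S: "finite S" "S \<subseteq> {x. poly (P k) x = 0}" "c \<noteq> 0"
    and nonneg: "\<And>x. 0 \<le> c * poly (P k) x * (\<Prod>s\<in>S. x - s)"
    using ex_roots_fixing_sign[OF nz] by blast
  define q where "q = (\<Prod>s\<in>S. [:-s, 1:])"
  have q_nz: "q \<noteq> 0"
    using S by (simp add: q_def)
  have poly_q: "poly q x = (\<Prod>s\<in>S. x - s)" for x
    by (simp add: q_def poly_prod)
  have "degree q = card S"
    unfolding q_def by (subst degree_prod_eq_sum_degree) auto
  have "k \<le> card S"
  proof (rule ccontr)
    assume "\<not> k \<le> card S"
    then have "((\<lambda>x. c * ((1 - x\<^sup>2) powr \<alpha> * poly (P k) x * poly q x)) has_integral c * 0) {-1..1}"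
      using \<open>degree q = card S\<close>
      by (intro has_integral_mult_right sym_jacobi_orthogonal_lower_degree[OF P]) auto
    then have "((\<lambda>x. (1 - x\<^sup>2) powr \<alpha> * poly (smult c (P k * q)) x) has_integral 0) {-1..1}"
      by (simp add: algebra_simps)
    then have "smult c (P k * q) = 0"
      by (rule weighted_integral_nonneg_poly_eq_0_imp) (use nonneg in \<open>simp add: poly_q mult.assoc\<close>)
    then show False
      using S nz q_nz by simp
  qed
  also have "card S \<le> card {x. poly (P k) x = 0}"
    using poly_roots_finite[OF nz] S by (intro card_mono)
  finally show "k \<le> card {x. poly (P k) x = 0}" .
qed

section \<open>Legendre polynomials\<close>

fun legendre_rec :: "nat \<Rightarrow> real poly" where
  "legendre_rec 0 = 1"
| "legendre_rec (Suc 0) = [:0, 1:]"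
| "legendre_rec (Suc (Suc k)) = smult (1 / (real k + 2))
     (smult (2 * real k + 3) (pCons 0 (legendre_rec (Suc k))) - smult (real k + 1) (legendre_rec k))"

lemmas legendre_rec_step = legendre_rec.simps(3)
declare legendre_rec.simps(3) [simp del]

lemma legendre_rec_recurrence:
  "(real k + 2) * poly (legendre_rec (Suc (Suc k))) x =
     (2 * real k + 3) * x * poly (legendre_rec (Suc k)) x - (real k + 1) * poly (legendre_rec k) x"
  by (simp add: legendre_rec_step)

lemma pderiv_legendre_rec_recurrence:
  "(real k + 2) * poly (pderiv (legendre_rec (Suc (Suc k)))) x =
     (2 * real k + 3) * (poly (legendre_rec (Suc k)) x + x * poly (pderiv (legendre_rec (Suc k))) x)
     - (real k + 1) * poly (pderiv (legendre_rec k)) x"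
  by (simp add: legendre_rec_step pderiv_smult pderiv_diff pderiv_pCons)
    (simp add: algebra_simps)

lemma degree_legendre_rec: "degree (legendre_rec k) = k"
proof -
  have "degree (legendre_rec k) \<le> k \<and> 0 < coeff (legendre_rec k) k"
  proof (induction k rule: legendre_rec.induct)
    case (3 k)
    have "degree (smult (2 * real k + 3) (pCons 0 (legendre_rec (Suc k)))) \<le> Suc (Suc k)"
      using 3 degree_pCons_le[of 0 "legendre_rec (Suc k)"] by (auto simp: degree_smult_eq)
    moreover have "degree (smult (real k + 1) (legendre_rec k)) \<le> Suc (Suc k)"
      using 3 by (auto simp: degree_smult_eq)
    ultimately have "degree (legendre_rec (Suc (Suc k))) \<le> Suc (Suc k)"
      unfolding legendre_rec_step
      by (intro order.trans[OF degree_smult_le degree_diff_le])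
    moreover have "coeff (legendre_rec k) (Suc (Suc k)) = 0"
      using 3 by (intro coeff_eq_0) auto
    ultimately show ?case
      using 3 by (simp add: legendre_rec_step)
  qed auto
  then show ?thesis
    by (metis antisym le_degree less_irrefl)
qed

lemma poly_legendre_rec_1: "poly (legendre_rec k) 1 = 1"
proof (induction k rule: legendre_rec.induct)
  case (3 k)
  then show ?case
    using legendre_rec_recurrence[of k 1] by simp
qed auto

lemma poly_legendre_rec_minus_1: "poly (legendre_rec k) (-1) = (-1) ^ k"
proof (induction k rule: legendre_rec.induct)
  case (3 k)
  then have "(real k + 2) * poly (legendre_rec (Suc (Suc k))) (-1) = (real k + 2) * (-1) ^ k"
    by (subst legendre_rec_recurrence) (simp add: algebra_simps)
  then show ?case by simp
qed auto

text \<open>Neither of the two classical derivative relations passes through the recurrence on its own,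
  so they are proved by a simultaneous induction.\<close>

lemma pderiv_legendre_rec_Suc:
  shows "poly (pderiv (legendre_rec (Suc k))) x =
      x * poly (pderiv (legendre_rec k)) x + (real k + 1) * poly (legendre_rec k) x" (is "?A k")
    and "x * poly (pderiv (legendre_rec (Suc k))) x - poly (pderiv (legendre_rec k)) x =
      (real k + 1) * poly (legendre_rec (Suc k)) x" (is "?B k")
proof -
  have "?A k \<and> ?B k"
  proof (induction k)
    case 0
    show ?case by (simp add: pderiv_pCons)
  next
    case (Suc k)
    let ?p = "poly (legendre_rec k) x" and ?q = "poly (legendre_rec (Suc k)) x"
      and ?r = "poly (legendre_rec (Suc (Suc k))) x"
    let ?p' = "poly (pderiv (legendre_rec k)) x" and ?q' = "poly (pderiv (legendre_rec (Suc k))) x"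
      and ?r' = "poly (pderiv (legendre_rec (Suc (Suc k)))) x"
    from Suc have a: "?q' = x * ?p' + (real k + 1) * ?p" and b: "?p' = x * ?q' - (real k + 1) * ?q"
      by auto
    have "(real k + 2) * ?r' = (2 * real k + 3) * (?q + x * ?q') - (real k + 1) * ?p'"
      by (rule pderiv_legendre_rec_recurrence)
    also have "\<dots> = (real k + 2) * (x * ?q' + (real k + 2) * ?q)"
      by (subst b) (simp add: algebra_simps)
    finally have A: "?r' = x * ?q' + (real k + 2) * ?q"
      by simp
    have "x * ?r' - ?q' = x * (x * ?q' - ?p') - (?q' - x * ?p') + (real k + 2) * x * ?q"
      by (simp add: A algebra_simps)
    also have "x * ?q' - ?p' = (real k + 1) * ?q"
      by (simp add: b)
    also have "?q' - x * ?p' = (real k + 1) * ?p"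
      using a by simp
    also have "x * ((real k + 1) * ?q) - (real k + 1) * ?p + (real k + 2) * x * ?q =
        (real k + 2) * ?r"
      by (subst legendre_rec_recurrence) (simp add: algebra_simps)
    finally show ?case
      using A by (simp add: algebra_simps)
  qed
  then show "?A k" "?B k" by auto
qed

lemma pderiv_legendre_rec_diff:
  "poly (pderiv (legendre_rec (Suc (Suc k)))) x - poly (pderiv (legendre_rec k)) x =
     (2 * real k + 3) * poly (legendre_rec (Suc k)) x"
  using pderiv_legendre_rec_Suc(1)[of "Suc k" x] pderiv_legendre_rec_Suc(2)[of x k]
  by (simp add: algebra_simps)

lemma legendre_rec_diff_eq_pderiv:
  "(real k + 1) * (real k + 2) * (poly (legendre_rec (Suc (Suc k))) x - poly (legendre_rec k) x) =
     (2 * real k + 3) * (x\<^sup>2 - 1) * poly (pderiv (legendre_rec (Suc k))) x"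
proof -
  let ?p = "poly (legendre_rec k) x" and ?q = "poly (legendre_rec (Suc k)) x"
  let ?p' = "poly (pderiv (legendre_rec k)) x" and ?q' = "poly (pderiv (legendre_rec (Suc k))) x"
  have "(x\<^sup>2 - 1) * ?q' = x * (x * ?q' - ?p') - (?q' - x * ?p')"
    by (simp add: power2_eq_square algebra_simps)
  also have "\<dots> = (real k + 1) * (x * ?q - ?p)"
    unfolding pderiv_legendre_rec_Suc(2)
    by (subst pderiv_legendre_rec_Suc(1)) (simp add: algebra_simps)
  finally have q': "(x\<^sup>2 - 1) * ?q' = (real k + 1) * (x * ?q - ?p)" .
  have "(real k + 2) * (poly (legendre_rec (Suc (Suc k))) x - ?p) = (2 * real k + 3) * (x * ?q - ?p)"
    unfolding right_diff_distrib legendre_rec_recurrence by (simp add: algebra_simps)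
  then show ?thesis
    using q' by (simp add: mult.assoc mult.left_commute)
qed

text \<open>Up to the factor \<open>2 k + 1\<close>, the polynomial \<open>(1 - x\<^sup>2) P\<^sub>k'\<close> is a multiple of \<open>P\<^sub>k\<^sub>+\<^sub>1 - P\<^sub>k\<^sub>-\<^sub>1\<close>, whose derivative is
  a multiple of \<open>P\<^sub>k\<close>.\<close>

lemma legendre_rec_ODE:
  "pderiv ([:1, 0, -1:] * pderiv (legendre_rec k)) =
     smult (- (real k * (real k + 1))) (legendre_rec k)"
proof (cases k)
  case 0
  then show ?thesis by (simp add: pderiv_1)
next
  case (Suc j)
  let ?c = "2 * real j + 3"
  have "smult ?c ([:1, 0, -1:] * pderiv (legendre_rec k)) =
      smult (- ((real j + 1) * (real j + 2))) (legendre_rec (Suc (Suc j)) - legendre_rec j)"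
    using legendre_rec_diff_eq_pderiv[of j]
    by (intro poly_eq_poly_eq_iff[THEN iffD1] ext)
      (simp add: Suc algebra_simps power2_eq_square)
  then have "pderiv (smult ?c ([:1, 0, -1:] * pderiv (legendre_rec k))) =
      pderiv (smult (- ((real j + 1) * (real j + 2))) (legendre_rec (Suc (Suc j)) - legendre_rec j))"
    by (rule arg_cong)
  also have "\<dots> =
      smult (- ((real j + 1) * (real j + 2))) (pderiv (legendre_rec (Suc (Suc j)) - legendre_rec j))"
    by (rule pderiv_smult)
  also have "pderiv (legendre_rec (Suc (Suc j)) - legendre_rec j) = smult ?c (legendre_rec k)"
    using pderiv_legendre_rec_diff[of j]
    by (intro poly_eq_poly_eq_iff[THEN iffD1] ext) (simp add: Suc pderiv_diff)
  finally have "smult ?c (pderiv ([:1, 0, -1:] * pderiv (legendre_rec k))) =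
      smult ?c (smult (- (real k * (real k + 1))) (legendre_rec k))"
    by (simp add: pderiv_smult Suc algebra_simps)
  then show ?thesis
    by (metis add_nonneg_pos less_irrefl mult_nonneg_nonneg of_nat_0_le_iff smult_cancel
        zero_le_numeral zero_less_numeral)
qed

lemma has_integral_pderiv:
  fixes p :: "real poly"
  assumes "a \<le> b" and f: "\<And>x. poly (pderiv p) x = f x"
  shows "(f has_integral poly p b - poly p a) {a..b}"
  unfolding f[symmetric] using \<open>a \<le> b\<close>
  by (intro fundamental_theorem_of_calculus)
    (auto simp: has_real_derivative_iff_has_vector_derivative[symmetric]
      intro: poly_DERIV has_field_derivative_at_within)

text \<open>Both polynomials are eigenfunctions of the same operator, for different eigenvalues. The
  polynomial \<open>p\<close> is the Wronskian expression that vanishes at both endpoints and whose derivative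
  is the integrand times the difference of the eigenvalues.\<close>

lemma legendre_rec_orthogonal:
  assumes "j \<noteq> k"
  shows "((\<lambda>x. poly (legendre_rec j) x * poly (legendre_rec k) x) has_integral 0) {-1..1}"
proof -
  let ?D = "\<lambda>k. [:1, 0, -1:] * pderiv (legendre_rec k)"
  let ?l = "\<lambda>k. real k * (real k + 1)"
  define p where "p = legendre_rec k * ?D j - legendre_rec j * ?D k"
  have "?l k - ?l j = (real k - real j) * (real k + real j + 1)"
    by (simp add: algebra_simps)
  then have nz: "?l k - ?l j \<noteq> 0"
    using assms by (simp add: add_nonneg_eq_0_iff)
  have deriv: "poly (pderiv p) x = (?l k - ?l j) * (poly (legendre_rec j) x * poly (legendre_rec k) x)" for x
    unfolding p_def pderiv_diff pderiv_mult[of "legendre_rec _"] legendre_rec_ODE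
    by (simp add: algebra_simps)
  have "poly p 1 = 0" "poly p (-1) = 0"
    by (simp_all add: p_def)
  then have "((\<lambda>x. (?l k - ?l j) * (poly (legendre_rec j) x * poly (legendre_rec k) x))
      has_integral 0) {-1..1}"
    using has_integral_pderiv[of "-1" 1 p, OF _ deriv] by simp
  then have "((\<lambda>x. inverse (?l k - ?l j) * ((?l k - ?l j) *
      (poly (legendre_rec j) x * poly (legendre_rec k) x))) has_integral inverse (?l k - ?l j) * 0) {-1..1}"
    by (rule has_integral_mult_right)
  then show ?thesis
    by (simp only: mult.assoc[symmetric] left_inverse[OF nz] mult_1_left mult_zero_right)
qed

lemma is_sym_jacobi_legendre_rec: "is_sym_jacobi 0 legendre_rec"
proof -
  \<comment> \<open>At \<open>-1\<close> and \<open>1\<close> the weight is \<open>0 powr 0 = 0\<close> instead of \<open>1\<close>.\<close>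
  have "((\<lambda>x. (1 - x\<^sup>2) powr 0 * poly (legendre_rec j) x * poly (legendre_rec k) x)
      has_integral 0) {-1..1}" if "j \<noteq> k" for j k
    by (rule has_integral_spike_finite[OF _ _ legendre_rec_orthogonal[OF that], of "{-1, 1}"])
      (auto simp: power2_eq_1_iff)
  moreover have "(real k + 0) gchoose k = 1" for k
    using binomial_gbinomial[of k k, where 'a = real] by simp
  ultimately show ?thesis
    by (simp add: is_sym_jacobi_def degree_legendre_rec poly_legendre_rec_1)
qed

lemma legendre_eq_legendre_rec: "legendre = legendre_rec"
  using is_sym_jacobi_legendre_rec by (rule sym_jacobi_eqI) simp

text \<open>These turn out to be the Jacobi polynomials for the weight \<open>1 - x\<^sup>2\<close>. The factor normalizes the
  value at \<open>1\<close>, which is \<open>(k + 1) (k + 2) / 2\<close> for the derivative and has to become \<open>k + 1\<close>.\<close>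

definition legendre_pderiv_scaled :: "nat \<Rightarrow> real poly" where
  "legendre_pderiv_scaled k = smult (2 / (real k + 2)) (pderiv (legendre_rec (Suc k)))"

lemma poly_pderiv_legendre_rec_1:
  "poly (pderiv (legendre_rec k)) 1 = real k * (real k + 1) / 2"
  by (induction k) (auto simp: pderiv_1 pderiv_legendre_rec_Suc(1) poly_legendre_rec_1 field_simps)

text \<open>Integration by parts of \<open>(1 - x\<^sup>2) P\<^sub>j' P\<^sub>k'\<close> reduces the claim, through the differential equation of
  \<open>P\<^sub>j\<close>, to the orthogonality of \<open>P\<^sub>j\<close> and \<open>P\<^sub>k\<close>; the boundary terms vanish with \<open>1 - x\<^sup>2\<close>.\<close>

lemma pderiv_legendre_rec_orthogonal:
  assumes "j \<noteq> k"
  shows "((\<lambda>x. (1 - x\<^sup>2) * (poly (pderiv (legendre_rec j)) x * poly (pderiv (legendre_rec k)) x))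
           has_integral 0) {-1..1}"
proof -
  let ?l = "real j * (real j + 1)"
  define p where "p = legendre_rec k * ([:1, 0, -1:] * pderiv (legendre_rec j))"
  have deriv: "poly (pderiv p) x =
      (1 - x\<^sup>2) * (poly (pderiv (legendre_rec j)) x * poly (pderiv (legendre_rec k)) x)
      - ?l * (poly (legendre_rec j) x * poly (legendre_rec k) x)" for x
    unfolding p_def pderiv_mult[of "legendre_rec _"] legendre_rec_ODE
    by (simp add: algebra_simps power2_eq_square)
  have "poly p 1 = 0" "poly p (-1) = 0"
    by (simp_all add: p_def)
  then have "((\<lambda>x. (1 - x\<^sup>2) * (poly (pderiv (legendre_rec j)) x * poly (pderiv (legendre_rec k)) x)
      - ?l * (poly (legendre_rec j) x * poly (legendre_rec k) x)) has_integral 0) {-1..1}"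
    using has_integral_pderiv[of "-1" 1 p, OF _ deriv] by simp
  from has_integral_add[OF this has_integral_mult_right[OF legendre_rec_orthogonal[OF assms], of ?l]]
  show ?thesis by simp
qed

lemma sym_jacobi_1_eq: "sym_jacobi 1 = legendre_pderiv_scaled"
proof (rule sym_jacobi_eqI)
  have deg: "degree (legendre_pderiv_scaled k) = k" for k
    by (simp add: legendre_pderiv_scaled_def degree_pderiv degree_legendre_rec)
  have "((\<lambda>x. (1 - x\<^sup>2) powr 1 * poly (legendre_pderiv_scaled j) x *
      poly (legendre_pderiv_scaled k) x) has_integral 0) {-1..1}" if "j \<noteq> k" for j k
  proof -
    let ?c = "2 / (real j + 2) * (2 / (real k + 2))"
    let ?f = "\<lambda>x. (1 - x\<^sup>2) * (poly (pderiv (legendre_rec (Suc j))) x *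
        poly (pderiv (legendre_rec (Suc k))) x)"
    have "((\<lambda>x. ?c * ?f x) has_integral ?c * 0) {-1..1}"
      using that by (intro has_integral_mult_right pderiv_legendre_rec_orthogonal) simp
    then show ?thesis
    proof (subst has_integral_cong)
      fix x :: real assume "x \<in> {-1..1}"
      then have "0 \<le> 1 - x\<^sup>2" by (auto simp: abs_square_le_1)
      then show "(1 - x\<^sup>2) powr 1 * poly (legendre_pderiv_scaled j) x *
          poly (legendre_pderiv_scaled k) x = ?c * ?f x"
        by (simp add: legendre_pderiv_scaled_def)
    qed simp
  qed
  moreover have "(real k + 1) gchoose k = real k + 1" for k
    using binomial_gbinomial[of "Suc k" k, where 'a = real] by (simp add: add.commute)
  ultimately show "is_sym_jacobi 1 legendre_pderiv_scaled"
    by (simp add: is_sym_jacobi_def deg)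
      (simp add: legendre_pderiv_scaled_def poly_pderiv_legendre_rec_1 field_simps)
qed simp

section \<open>The Gauss--Legendre polynomials\<close>

text \<open>The numbering reaches \<open>n\<close> only because there are \<open>n\<close> distinct zeros.\<close>

lemma gl_node_root:
  assumes "1 \<le> i" "i \<le> n"
  shows "poly (legendre_rec n) (gl_node n i) = 0"
proof -
  let ?S = "{x. poly (legendre_rec n) x = 0}"
  have "card ?S = n"
    using card_roots_sym_jacobi[OF is_sym_jacobi_legendre_rec] by simp
  then have "finite ?S"
    using assms by (intro card_ge_0_finite) simp
  then have "sorted_list_of_set ?S ! (i - 1) \<in> ?S"
    using \<open>card ?S = n\<close> assms
    by (metis (no_types, lifting) One_nat_def Suc_le_lessD Suc_pred length_sorted_list_of_set
        less_le_trans nth_mem set_sorted_list_of_set zero_less_one)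
  then show ?thesis
    by (simp add: gl_node_def legendre_eq_legendre_rec)
qed

lemma christoffel_darboux:
  "(x - y) * (\<Sum>k\<le>n. (2 * real k + 1) * poly (legendre_rec k) x * poly (legendre_rec k) y) =
     (real n + 1) * (poly (legendre_rec (Suc n)) x * poly (legendre_rec n) y -
       poly (legendre_rec n) x * poly (legendre_rec (Suc n)) y)"
proof (induction n)
  case (Suc n)
  let ?p = "\<lambda>k. poly (legendre_rec k)"
  have "(real n + 2) * (?p (Suc (Suc n)) x * ?p (Suc n) y - ?p (Suc n) x * ?p (Suc (Suc n)) y) =
      ((real n + 2) * ?p (Suc (Suc n)) x) * ?p (Suc n) y -
      ?p (Suc n) x * ((real n + 2) * ?p (Suc (Suc n)) y)"
    by (simp add: algebra_simps)
  also have "\<dots> = (x - y) * ((2 * real n + 3) * ?p (Suc n) x * ?p (Suc n) y) +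
      (real n + 1) * (?p (Suc n) x * ?p n y - ?p n x * ?p (Suc n) y)"
    unfolding legendre_rec_recurrence by (simp add: algebra_simps)
  finally show ?case
    unfolding sum.atMost_Suc distrib_left Suc.IH by (simp add: algebra_simps)
qed simp

lemma legendre_diff_0: "legendre_diff 0 = legendre_rec 1"
  by (simp add: legendre_diff_def legendre_eq_legendre_rec)

lemma legendre_diff_Suc: "legendre_diff (Suc k) = legendre_rec (Suc (Suc k)) - legendre_rec k"
  by (simp add: legendre_diff_def legendre_eq_legendre_rec)

lemma pderiv_legendre_diff:
  "poly (pderiv (legendre_diff k)) x = (2 * real k + 1) * poly (legendre_rec k) x"
proof (cases k)
  case 0
  then show ?thesis by (simp add: legendre_diff_0 pderiv_pCons)
next
  case (Suc j)
  then show ?thesis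
    using pderiv_legendre_rec_diff[of j x] by (simp add: legendre_diff_Suc pderiv_diff)
qed

lemma poly_legendre_diff_minus_1:
  "poly (legendre_diff k) (-1) = (if k = 0 then -1 else 0)"
  by (cases k) (auto simp: legendre_diff_0 legendre_diff_Suc poly_legendre_rec_minus_1)

text \<open>At a zero \<open>\<tau>\<close> one of the two terms on the right-hand side of the Christoffel--Darboux identity
  vanishes. The identity then holds after multiplication by \<open>x - \<tau>\<close>; cancelling this factor as
  polynomials gives it also for \<open>x = \<tau>\<close>.\<close>

lemma legendre_quotient_expansion:
  assumes root: "poly (legendre_rec (Suc m)) \<tau> = 0"
  shows "(real m + 1) * poly (legendre_rec m) \<tau> * poly (legendre_rec (Suc m) div [:-\<tau>, 1:]) x =
    (\<Sum>k\<le>m. (2 * real k + 1) * poly (legendre_rec k) \<tau> * poly (legendre_rec k) x)"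
proof -
  let ?q = "legendre_rec (Suc m) div [:-\<tau>, 1:]"
  define s where "s = (\<Sum>k\<le>m. smult ((2 * real k + 1) * poly (legendre_rec k) \<tau>) (legendre_rec k))"
  have "[:-\<tau>, 1:] dvd legendre_rec (Suc m)"
    using root by (simp add: poly_eq_0_iff_dvd)
  then have q: "[:-\<tau>, 1:] * ?q = legendre_rec (Suc m)"
    by (rule dvd_mult_div_cancel)
  have "poly ([:-\<tau>, 1:] * smult ((real m + 1) * poly (legendre_rec m) \<tau>) ?q) y =
      poly ([:-\<tau>, 1:] * s) y" for y
  proof -
    have "poly ([:-\<tau>, 1:] * smult ((real m + 1) * poly (legendre_rec m) \<tau>) ?q) y =
        (real m + 1) * poly (legendre_rec m) \<tau> * poly (legendre_rec (Suc m)) y"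
      unfolding mult_smult_right q by simp
    also have "\<dots> = (y - \<tau>) * poly s y"
      using christoffel_darboux[of y \<tau> m] root by (simp add: s_def poly_sum algebra_simps)
    finally show ?thesis by (simp add: algebra_simps)
  qed
  then have "[:-\<tau>, 1:] * smult ((real m + 1) * poly (legendre_rec m) \<tau>) ?q = [:-\<tau>, 1:] * s"
    by (intro poly_eq_poly_eq_iff[THEN iffD1] ext)
  then have "smult ((real m + 1) * poly (legendre_rec m) \<tau>) ?q = s"
    by (subst (asm) mult_cancel_left) auto
  then have "poly (smult ((real m + 1) * poly (legendre_rec m) \<tau>) ?q) x = poly s x"
    by simp
  then show ?thesis
    by (simp add: s_def poly_sum)
qed

text \<open>The polynomial \<open>p\<close> below is an antiderivative of the expanded integrand. Its value at \<open>-1\<close> is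
  \<open>-1\<close>, from the term with \<open>k = 0\<close>, and this cancels the constant \<open>-1/2\<close> in the definition of \<open>gl_G\<close>.\<close>

lemma gl_G_eq_sum_legendre_diff:
  assumes "1 \<le> i" "i \<le> n" "-1 \<le> t"
  shows "gl_G n i t =
    1/2 * (\<Sum>k<n. poly (legendre_rec k) (gl_node n i) * poly (legendre_diff k) t)"
proof -
  define \<tau> where "\<tau> = gl_node n i"
  obtain m where n: "n = Suc m"
    using assms by (cases n) auto
  have root: "poly (legendre_rec (Suc m)) \<tau> = 0"
    unfolding \<tau>_def n[symmetric] using assms by (intro gl_node_root) auto
  let ?c = "(real m + 1) * poly (legendre_rec m) \<tau>"
  let ?q = "legendre_rec (Suc m) div [:-\<tau>, 1:]"
  define p where "p = (\<Sum>k<n. smult (poly (legendre_rec k) \<tau>) (legendre_diff k))"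
  have "poly (pderiv p) x = ?c * poly ?q x" for x
    unfolding legendre_quotient_expansion[OF root]
    by (simp add: p_def higher_pderiv_sum[of 1, simplified] pderiv_smult poly_sum pderiv_legendre_diff n
        lessThan_Suc_atMost algebra_simps)
  then have "((\<lambda>x. ?c * poly ?q x) has_integral poly p t - poly p (-1)) {-1..t}"
    using assms by (intro has_integral_pderiv)
  then have "integral {-1..t} (\<lambda>x. ?c * poly ?q x) = poly p t - poly p (-1)"
    by (rule integral_unique)
  then have "?c * integral {-1..t} (poly ?q) = poly p t - poly p (-1)"
    by simp
  moreover have "poly p (-1) = -1"
    by (simp add: p_def poly_sum poly_legendre_diff_minus_1 n sum.lessThan_Suc_shift
        del: sum.lessThan_Suc)
  ultimately have "?c * integral {-1..t} (poly ?q) = poly p t + 1"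
    by simp
  moreover have "gl_G n i t = ?c * integral {-1..t} (poly ?q) / 2 - 1/2"
    using assms by (simp add: gl_G_def legendre_eq_legendre_rec n \<tau>_def algebra_simps)
  ultimately show ?thesis
    by (simp add: p_def poly_sum \<tau>_def field_simps)
qed

text \<open>Abel summation, in a form that is symmetric in \<open>x\<close> and \<open>y\<close>; the boundary terms have the indices
  \<open>m\<close> and \<open>m + 1\<close>, so that one of them vanishes when \<open>x\<close> is a zero of the polynomial of degree \<open>m + 1\<close>.\<close>

lemma sum_legendre_diff_by_parts:
  "(\<Sum>k\<le>m. poly (legendre_rec k) x * poly (legendre_diff k) y) =
     poly (legendre_rec m) x * poly (legendre_rec (Suc m)) y
     + poly (legendre_rec (Suc m)) x * poly (legendre_rec m) y
     - (\<Sum>k\<le>m. poly (legendre_diff k) x * poly (legendre_rec k) y)"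
proof (induction m)
  case 0
  show ?case by (simp add: legendre_diff_0)
next
  case (Suc m)
  then show ?case by (simp add: legendre_diff_Suc algebra_simps)
qed

lemma gl_G_eq_legendre_sum:
  assumes "1 \<le> i" "i \<le> n" "-1 \<le> t"
  shows "gl_G n i t = 1/2 * poly (legendre (n - 1)) (gl_node n i) * poly (legendre n) t
    - 1/2 * (\<Sum>k<n. poly (legendre_diff k) (gl_node n i) * poly (legendre k) t)"
proof -
  obtain m where n: "n = Suc m"
    using assms by (cases n) auto
  have "poly (legendre_rec (Suc m)) (gl_node n i) = 0"
    unfolding n[symmetric] using assms by (intro gl_node_root) auto
  then show ?thesis
    unfolding gl_G_eq_sum_legendre_diff[OF assms] legendre_eq_legendre_rec
    by (simp add: n lessThan_Suc_atMost sum_legendre_diff_by_parts algebra_simps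
        del: sum.lessThan_Suc sum.atMost_Suc)
qed

lemma legendre_diff_Suc_eq_jacobi:
  "poly (legendre_diff (Suc k)) x =
     (x\<^sup>2 - 1) * ((2 * real k + 3) / (real k + 1)) / 2 * poly (sym_jacobi 1 k) x"
proof -
  have "(real k + 1) * (real k + 2) * poly (legendre_diff (Suc k)) x =
      (2 * real k + 3) * (x\<^sup>2 - 1) * poly (pderiv (legendre_rec (Suc k))) x"
    unfolding legendre_diff_Suc poly_diff by (rule legendre_rec_diff_eq_pderiv)
  moreover have "(real k + 1) * (real k + 2) \<noteq> 0"
    by (simp add: add_nonneg_eq_0_iff)
  ultimately have "poly (legendre_diff (Suc k)) x =
      (2 * real k + 3) * (x\<^sup>2 - 1) * poly (pderiv (legendre_rec (Suc k))) x /
        ((real k + 1) * (real k + 2))"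
    by (metis nonzero_mult_div_cancel_left)
  moreover have "v * u * w / (b * c) = u * (v / b) / 2 * (2 / c * w)" for u v w b c :: real
    by simp
  ultimately show ?thesis
    by (simp only: sym_jacobi_1_eq legendre_pderiv_scaled_def poly_smult)
qed

lemma gl_G_eq_jacobi_sum:
  assumes "1 \<le> i" "i \<le> n" "-1 \<le> t"
  shows "gl_G n i t = 1/2 * t + 1/2 * (t\<^sup>2 - 1) *
    (\<Sum>k=1..n-1. (2 * real k + 1) / (2 * real k) * poly (legendre k) (gl_node n i)
      * poly (sym_jacobi 1 (k - 1)) t)"
proof -
  obtain m where n: "n = Suc m"
    using assms by (cases n) auto
  let ?p = "\<lambda>k. poly (legendre_rec k) (gl_node n i)"
  have "(\<Sum>k<n. ?p k * poly (legendre_diff k) t) =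
      t + (\<Sum>k<m. ?p (Suc k) * poly (legendre_diff (Suc k)) t)"
    by (simp add: n sum.lessThan_Suc_shift legendre_diff_0 del: sum.lessThan_Suc)
  also have "(\<Sum>k<m. ?p (Suc k) * poly (legendre_diff (Suc k)) t) =
      (t\<^sup>2 - 1) * (\<Sum>k<m. (2 * real (Suc k) + 1) / (2 * real (Suc k)) * ?p (Suc k)
        * poly (sym_jacobi 1 (Suc k - 1)) t)"
    unfolding sum_distrib_left legendre_diff_Suc_eq_jacobi
    by (intro sum.cong) (simp_all add: field_simps)
  also have "(\<Sum>k<m. (2 * real (Suc k) + 1) / (2 * real (Suc k)) * ?p (Suc k)
        * poly (sym_jacobi 1 (Suc k - 1)) t) =
      (\<Sum>k=1..n-1. (2 * real k + 1) / (2 * real k) * ?p k * poly (sym_jacobi 1 (k - 1)) t)"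
    by (simp add: n sum.atLeast1_atMost_eq)
  finally show ?thesis
    unfolding gl_G_eq_sum_legendre_diff[OF assms] legendre_eq_legendre_rec
    by (simp add: algebra_simps)
qed

lemma gl_F_legendre_form:
  assumes "-1 < t"
  shows gl_F_legendre_form_inner: "1 \<le> i \<Longrightarrow> i \<le> n - 1 \<Longrightarrow> gl_F n i t =
      1/2 * (poly (legendre (n - 1)) (gl_node n i) - poly (legendre (n - 1)) (gl_node n (i + 1)))
          * poly (legendre n) t
      + 1/2 * (\<Sum>k<n. (poly (legendre_diff k) (gl_node n (i + 1))
                         - poly (legendre_diff k) (gl_node n i)) * poly (legendre k) t)"
    and gl_F_legendre_form_first: "n \<ge> 1 \<Longrightarrow> gl_F n 0 t =
      1/2 - 1/2 * poly (legendre (n - 1)) (gl_node n 1) * poly (legendre n) t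
      + 1/2 * (\<Sum>k<n. poly (legendre_diff k) (gl_node n 1) * poly (legendre k) t)"
    and gl_F_legendre_form_last: "n \<ge> 1 \<Longrightarrow> gl_F n n t =
      1/2 + 1/2 * poly (legendre (n - 1)) (gl_node n n) * poly (legendre n) t
      - 1/2 * (\<Sum>k<n. poly (legendre_diff k) (gl_node n n) * poly (legendre k) t)"
proof -
  note G = gl_G_eq_legendre_sum[OF _ _ less_imp_le[OF assms]]
  have G0: "gl_G n 0 t = 1/2" and Gn: "gl_G n (n + 1) t = - 1/2"
    by (auto simp: gl_G_def)
  show "gl_F n i t =
      1/2 * (poly (legendre (n - 1)) (gl_node n i) - poly (legendre (n - 1)) (gl_node n (i + 1)))
          * poly (legendre n) t
      + 1/2 * (\<Sum>k<n. (poly (legendre_diff k) (gl_node n (i + 1))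
                         - poly (legendre_diff k) (gl_node n i)) * poly (legendre k) t)"
    if i: "1 \<le> i" "i \<le> n - 1"
  proof -
    have "i \<le> n" "1 \<le> i + 1" "i + 1 \<le> n" using i by auto
    then show ?thesis
      unfolding gl_F_def G[OF i(1) \<open>i \<le> n\<close>] G[OF \<open>1 \<le> i + 1\<close> \<open>i + 1 \<le> n\<close>]
      by (simp add: algebra_simps sum_subtractf)
  qed
  show "gl_F n 0 t =
      1/2 - 1/2 * poly (legendre (n - 1)) (gl_node n 1) * poly (legendre n) t
      + 1/2 * (\<Sum>k<n. poly (legendre_diff k) (gl_node n 1) * poly (legendre k) t)" if "n \<ge> 1"
    using G[OF order.refl that] by (simp add: gl_F_def G0)
  show "gl_F n n t =
      1/2 + 1/2 * poly (legendre (n - 1)) (gl_node n n) * poly (legendre n) t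
      - 1/2 * (\<Sum>k<n. poly (legendre_diff k) (gl_node n n) * poly (legendre k) t)" if "n \<ge> 1"
    using G[OF that order.refl] Gn by (simp add: gl_F_def)
qed

lemma gl_F_jacobi_form:
  assumes "-1 < t"
  shows gl_F_jacobi_form_inner: "1 \<le> i \<Longrightarrow> i \<le> n - 1 \<Longrightarrow> gl_F n i t =
      1/2 * (t\<^sup>2 - 1) * (\<Sum>k=1..n-1. (2 * real k + 1) / (2 * real k)
          * (poly (legendre k) (gl_node n i) - poly (legendre k) (gl_node n (i + 1)))
          * poly (sym_jacobi 1 (k - 1)) t)"
    and gl_F_jacobi_form_first: "n \<ge> 1 \<Longrightarrow> gl_F n 0 t =
      1 - 1/2 * (t + 1) * (1 + (t - 1) * (\<Sum>k=1..n-1. (2 * real k + 1) / (2 * real k)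
          * poly (legendre k) (gl_node n 1) * poly (sym_jacobi 1 (k - 1)) t))"
    and gl_F_jacobi_form_last: "n \<ge> 1 \<Longrightarrow> gl_F n n t =
      1/2 * (t + 1) * (1 + (t - 1) * (\<Sum>k=1..n-1. (2 * real k + 1) / (2 * real k)
          * poly (legendre k) (gl_node n n) * poly (sym_jacobi 1 (k - 1)) t))"
proof -
  note G = gl_G_eq_jacobi_sum[OF _ _ less_imp_le[OF assms]]
  have G0: "gl_G n 0 t = 1/2" and Gn: "gl_G n (n + 1) t = - 1/2"
    by (auto simp: gl_G_def)
  \<comment> \<open>The term \<open>t / 2\<close>, which comes from \<open>k = 0\<close>, cancels in the differences of inner neighbours and
    combines with the constant values of \<open>gl_G\<close> at the two ends.\<close>
  have factor: "1/2 * t + 1/2 * (t\<^sup>2 - 1) * s = 1/2 * (t + 1) * (1 + (t - 1) * s) - 1/2" for s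
    by (simp add: power2_eq_square field_simps)
  show "gl_F n i t =
      1/2 * (t\<^sup>2 - 1) * (\<Sum>k=1..n-1. (2 * real k + 1) / (2 * real k)
          * (poly (legendre k) (gl_node n i) - poly (legendre k) (gl_node n (i + 1)))
          * poly (sym_jacobi 1 (k - 1)) t)" if i: "1 \<le> i" "i \<le> n - 1"
  proof -
    have "i \<le> n" "1 \<le> i + 1" "i + 1 \<le> n" using i by auto
    then show ?thesis
      unfolding gl_F_def G[OF i(1) \<open>i \<le> n\<close>] G[OF \<open>1 \<le> i + 1\<close> \<open>i + 1 \<le> n\<close>]
      by (simp only: left_diff_distrib right_diff_distrib sum_subtractf)
  qed
  show "gl_F n 0 t =
      1 - 1/2 * (t + 1) * (1 + (t - 1) * (\<Sum>k=1..n-1. (2 * real k + 1) / (2 * real k)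
          * poly (legendre k) (gl_node n 1) * poly (sym_jacobi 1 (k - 1)) t))" if "n \<ge> 1"
    using G[OF order.refl that] unfolding gl_F_def G0 factor by simp
  show "gl_F n n t =
      1/2 * (t + 1) * (1 + (t - 1) * (\<Sum>k=1..n-1. (2 * real k + 1) / (2 * real k)
          * poly (legendre k) (gl_node n n) * poly (sym_jacobi 1 (k - 1)) t))" if "n \<ge> 1"
    using G[OF that order.refl] unfolding gl_F_def Gn factor by simp
qed

section \<open>Straight-line programs\<close>

lemma exec_append: "exec (p @ q) m = exec q (exec p m)"
  by (induction p m rule: exec.induct) (auto simp: fun_upd_def)

lemma cost_append: "cost (p @ q) = cost p + cost q"
  by (induction p rule: cost.induct) auto

fun target :: "instr \<Rightarrow> var" where
  "target (x ::= a) = x"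

lemma exec_unchanged:
  "x \<notin> target ` set p \<Longrightarrow> exec p m x = m x"
  by (induction p m rule: exec.induct) auto

text \<open>A loop whose iterations establish independent facts: \<open>I\<close> is an invariant and \<open>Q i\<close> is what
  iteration \<open>i\<close> achieves and no other iteration destroys.\<close>

lemma exec_loop:
  assumes "I m"
    and step: "\<And>i m. i \<in> set xs \<Longrightarrow> I m \<Longrightarrow> I (exec (body i) m) \<and> Q i (exec (body i) m)"
    and keep: "\<And>i j m. i \<in> set xs \<Longrightarrow> j \<in> set xs \<Longrightarrow> i \<noteq> j \<Longrightarrow> Q i m \<Longrightarrow> Q i (exec (body j) m)"
  shows "I (exec (concat (map body xs)) m) \<and> (\<forall>i\<in>set xs. Q i (exec (concat (map body xs)) m))"
  using step keep
proof (induction xs rule: rev_induct)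
  case Nil
  then show ?case using \<open>I m\<close> by simp
next
  case (snoc j xs)
  let ?m = "exec (concat (map body xs)) m"
  have IH: "I ?m \<and> (\<forall>i\<in>set xs. Q i ?m)"
    using snoc.prems by (intro snoc.IH) auto
  have "I (exec (body j) ?m)" "Q j (exec (body j) ?m)"
    using snoc.prems(1)[of j] IH by auto
  moreover have "Q i (exec (body j) ?m)" if "i \<in> set xs" for i
    using that snoc.prems(2)[of i j ?m] IH \<open>Q j (exec (body j) ?m)\<close> by (cases "i = j") auto
  ultimately show ?case
    by (simp add: exec_append)
qed

text \<open>Assignments to distinct variables behave as a simultaneous assignment if the right-hand sides
  do not read any of the variables that are assigned.\<close>

lemma exec_assign_family:
  assumes "\<And>k k'. k \<in> set xs \<Longrightarrow> k' \<in> set xs \<Longrightarrow> c k = c k' \<Longrightarrow> k = k'"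
    and indep: "\<And>k m'. k \<in> set xs \<Longrightarrow> (\<And>x. x \<notin> c ` set xs \<Longrightarrow> m' x = m x) \<Longrightarrow> aval (a k) m' = v k"
    and "k \<in> set xs"
  shows "exec (map (\<lambda>k. c k ::= a k) xs) m (c k) = v k"
proof -
  let ?I = "\<lambda>m'. \<forall>x. x \<notin> c ` set xs \<longrightarrow> m' x = m x"
  have "?I (exec (concat (map (\<lambda>k. [c k ::= a k]) xs)) m) \<and>
      (\<forall>k\<in>set xs. exec (concat (map (\<lambda>k. [c k ::= a k]) xs)) m (c k) = v k)"
    by (rule exec_loop) (use assms(1) indep in auto)
  moreover have "concat (map (\<lambda>k. [c k ::= a k]) xs) = map (\<lambda>k. c k ::= a k) xs"
    by (induction xs) auto
  ultimately show ?thesis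
    using \<open>k \<in> set xs\<close> by simp
qed

section \<open>The Clenshaw algorithm\<close>

text \<open>The values of the expressions \<open>xi1\<close> and \<open>xi2\<close>, which are independent of the memory.\<close>

definition xi1_val :: "nat \<Rightarrow> nat \<Rightarrow> real" where
  "xi1_val a k = (real k + real a) * (2 * real k + 2 * real a - 1) / (real k * (real k + 2 * real a))"

definition xi2_val :: "nat \<Rightarrow> nat \<Rightarrow> real" where
  "xi2_val a k = (real k + real a - 1) * (real k + real a) / (real k * (real k + 2 * real a))"

lemma aval_xi: "aval (xi1 (Num a) k) m = xi1_val a k" "aval (xi2 (Num a) k) m = xi2_val a k"
  by (simp_all add: xi1_def xi2_def xi1_val_def xi2_val_def)

text \<open>The loop runs downwards. Once the steps with indices at least \<open>N\<close> are done, the whole sum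
  equals
  \<open>v\<^sub>0 p\<^sub>0 + \<dots> + v\<^sub>N\<^sub>-\<^sub>1 p\<^sub>N\<^sub>-\<^sub>1 + B\<^sub>N p\<^sub>N - \<xi>\<^sub>2(N + 1) B\<^sub>N\<^sub>+\<^sub>1 p\<^sub>N\<^sub>-\<^sub>1\<close>, with \<open>p\<^sub>-\<^sub>1 = 0\<close>:
  the recurrence for \<open>p\<^sub>N\<^sub>+\<^sub>1\<close> turns this expression for \<open>N + 1\<close> into that for \<open>N\<close>.\<close>

lemma clenshaw_loop:
  fixes p :: "nat \<Rightarrow> real"
  assumes p0: "p 0 = 1"
    and rec: "\<And>k. p (Suc k) =
      x * xi1_val a (Suc k) * p k - (if k = 0 then 0 else xi2_val a (Suc k) * p (k - 1))"
    and "m Param = x"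
  shows "exec (map (\<lambda>k. Clen k ::= Var (Coef k) \<oplus> Var Param \<otimes> xi1 (Num a) (k + 1) \<otimes> Var (Clen (k + 1))
                        \<ominus> xi2 (Num a) (k + 2) \<otimes> Var (Clen (k + 2))) (rev [0..<N])) m (Clen 0) =
    (\<Sum>k<N. m (Coef k) * p k) + m (Clen N) * p N
      - (if N = 0 then 0 else xi2_val a (Suc N) * m (Clen (Suc N)) * p (N - 1))"
  using \<open>m Param = x\<close>
proof (induction N arbitrary: m)
  case 0
  then show ?case by (simp add: p0)
next
  case (Suc N)
  let ?loop = "\<lambda>N. map (\<lambda>k. Clen k ::= Var (Coef k) \<oplus> Var Param \<otimes> xi1 (Num a) (k + 1) \<otimes> Var (Clen (k + 1))
                        \<ominus> xi2 (Num a) (k + 2) \<otimes> Var (Clen (k + 2))) (rev [0..<N])"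
  let ?b = "m (Coef N) + x * xi1_val a (Suc N) * m (Clen (Suc N))
      - xi2_val a (Suc (Suc N)) * m (Clen (Suc (Suc N)))"
  let ?m = "m(Clen N := ?b)"
  have step: "exec (?loop (Suc N)) m = exec (?loop N) ?m"
    using Suc.prems by (simp add: aval_xi)
  have "?m Param = x"
    using Suc.prems by simp
  note IH = Suc.IH[where m = ?m, OF this]
  show ?case
    unfolding step IH by (simp add: rec[of N]) (simp add: p0 algebra_simps)
qed

lemma exec_clenshaw:
  fixes p :: "nat \<Rightarrow> real"
  assumes "p 0 = 1"
    and "\<And>k. p (Suc k) =
      x * xi1_val a (Suc k) * p k - (if k = 0 then 0 else xi2_val a (Suc k) * p (k - 1))"
    and "m Param = x"
  shows "exec (clenshaw (Num a) N) m (Clen 0) = (\<Sum>k<N. m (Coef k) * p k)"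
  unfolding clenshaw_def exec_append using assms
  by (subst clenshaw_loop[of p x a]) (simp_all add: aval_xi)

lemma legendre_clenshaw_recurrence:
  "poly (legendre (Suc k)) x = x * xi1_val 0 (Suc k) * poly (legendre k) x
     - (if k = 0 then 0 else xi2_val 0 (Suc k) * poly (legendre (k - 1)) x)"
proof (cases k)
  case 0
  then show ?thesis by (simp add: legendre_eq_legendre_rec xi1_val_def)
next
  case (Suc j)
  have "poly (legendre_rec (Suc (Suc j))) x = ((2 * real j + 3) * x * poly (legendre_rec (Suc j)) x
      - (real j + 1) * poly (legendre_rec j) x) / (real j + 2)"
    using legendre_rec_recurrence[of j x] by (simp add: field_simps)
  moreover have "xi1_val 0 (Suc k) = (2 * real j + 3) / (real j + 2)"
    "xi2_val 0 (Suc k) = (real j + 1) / (real j + 2)"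
    by (simp_all add: xi1_val_def xi2_val_def Suc divide_simps) (simp_all add: algebra_simps)
  ultimately show ?thesis
    by (simp add: legendre_eq_legendre_rec Suc diff_divide_distrib)
qed

text \<open>The two derivative relations express \<open>P\<^sub>k\<^sub>+\<^sub>1\<close> and the next derivative through \<open>P\<^sub>k'\<close> and \<open>P\<^sub>k\<^sub>+\<^sub>1'\<close>; eliminating
  \<open>P\<^sub>k\<^sub>+\<^sub>1\<close> leaves a recurrence for the derivatives alone.\<close>

lemma pderiv_legendre_rec_three_term:
  "(real k + 1) * poly (pderiv (legendre_rec (Suc (Suc k)))) x =
     (2 * real k + 3) * x * poly (pderiv (legendre_rec (Suc k))) x
     - (real k + 2) * poly (pderiv (legendre_rec k)) x"
proof -
  have "poly (pderiv (legendre_rec (Suc (Suc k)))) x =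
      x * poly (pderiv (legendre_rec (Suc k))) x + (real k + 2) * poly (legendre_rec (Suc k)) x"
    using pderiv_legendre_rec_Suc(1)[of "Suc k" x] by simp
  then have "(real k + 1) * poly (pderiv (legendre_rec (Suc (Suc k)))) x =
      (real k + 1) * x * poly (pderiv (legendre_rec (Suc k))) x
      + (real k + 2) * ((real k + 1) * poly (legendre_rec (Suc k)) x)"
    by (simp add: algebra_simps)
  then show ?thesis
    unfolding pderiv_legendre_rec_Suc(2)[symmetric] by (simp add: algebra_simps)
qed

lemma jacobi_clenshaw_recurrence:
  "poly (sym_jacobi 1 (Suc k)) x = x * xi1_val 1 (Suc k) * poly (sym_jacobi 1 k) x
     - (if k = 0 then 0 else xi2_val 1 (Suc k) * poly (sym_jacobi 1 (k - 1)) x)"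
proof (cases k)
  case 0
  have "poly (pderiv (legendre_rec (Suc (Suc 0)))) x = 3 * x"
    using pderiv_legendre_rec_three_term[of 0 x] by (simp add: pderiv_pCons)
  then show ?thesis
    by (simp add: 0 sym_jacobi_1_eq legendre_pderiv_scaled_def xi1_val_def pderiv_pCons)
next
  case (Suc j)
  let ?d = "\<lambda>k. poly (pderiv (legendre_rec k)) x"
  have d: "?d (Suc (Suc (Suc j))) =
      ((2 * real j + 5) * x * ?d (Suc (Suc j)) - (real j + 3) * ?d (Suc j)) / (real j + 2)"
    using pderiv_legendre_rec_three_term[of "Suc j" x] by (simp add: field_simps)
  have xi: "xi1_val 1 (Suc (Suc j)) = (real j + 3) * (2 * real j + 5) / ((real j + 2) * (real j + 4))"
    "xi2_val 1 (Suc (Suc j)) = (real j + 3) / (real j + 4)"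
    by (simp_all add: xi1_val_def xi2_val_def divide_simps) (simp_all add: algebra_simps)
  have J: "poly (sym_jacobi 1 j) x = 2 * ?d (Suc j) / (real j + 2)"
    "poly (sym_jacobi 1 (Suc j)) x = 2 * ?d (Suc (Suc j)) / (real j + 3)"
    "poly (sym_jacobi 1 (Suc (Suc j))) x = 2 * ?d (Suc (Suc (Suc j))) / (real j + 4)"
    by (simp_all add: sym_jacobi_1_eq legendre_pderiv_scaled_def add.commute)
  \<comment> \<open>The identity that remains when \<open>u\<close> and \<open>v\<close> stand for the values of the derivatives of
    \<open>P\<^sub>j\<^sub>+\<^sub>1\<close> and \<open>P\<^sub>j\<^sub>+\<^sub>2\<close>.\<close>
  have "2 * (((2 * real j + 5) * x * v - (real j + 3) * u) / (real j + 2)) / (real j + 4) =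
      x * ((real j + 3) * (2 * real j + 5) / ((real j + 2) * (real j + 4))) * (2 * v / (real j + 3))
      - (real j + 3) / (real j + 4) * (2 * u / (real j + 2))" for u v
    by (simp add: divide_simps)
  then show ?thesis
    by (simp only: Suc xi J d diff_Suc_1 nat.distinct if_False)
qed

section \<open>Correctness of the programs\<close>

definition legendre_table :: "nat \<Rightarrow> (var \<Rightarrow> real) \<Rightarrow> bool" where
  "legendre_table n m \<longleftrightarrow>
     (\<forall>i\<in>{1..n}. \<forall>k\<le>n. m (LegAt k i) = poly (legendre k) (gl_node n i))"

lemma exec_three_term_recurrence:
  assumes "n \<ge> 1" and "m (LegAt 0 i) = 1" "m (LegAt 1 i) = m (Node i)" "k \<le> n"
  shows "exec (map (\<lambda>k. LegAt (k + 1) i ::=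
            ((Num 2 \<otimes> Num k \<oplus> Num 1) \<otimes> Var (Node i) \<otimes> Var (LegAt k i)
               \<ominus> Num k \<otimes> Var (LegAt (k - 1) i)) \<oslash> (Num k \<oplus> Num 1)) [1..<n]) m (LegAt k i) =
    poly (legendre k) (m (Node i))"
  using assms(1,4)
proof (induction n arbitrary: k rule: nat_induct_at_least)
  case base
  then have "k = 0 \<or> k = 1" by auto
  then show ?case
    using assms by (auto simp: legendre_eq_legendre_rec)
next
  case (Suc n)
  let ?loop = "\<lambda>n. map (\<lambda>k. LegAt (k + 1) i ::=
      ((Num 2 \<otimes> Num k \<oplus> Num 1) \<otimes> Var (Node i) \<otimes> Var (LegAt k i)
         \<ominus> Num k \<otimes> Var (LegAt (k - 1) i)) \<oslash> (Num k \<oplus> Num 1)) [1..<n]"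
  let ?x = "m (Node i)" and ?m = "exec (?loop n) m"
  have node: "?m (Node i) = ?x"
    by (rule exec_unchanged) auto
  have loop: "exec (?loop (Suc n)) m = ?m(LegAt (Suc n) i :=
      ((2 * real n + 1) * ?x * poly (legendre n) ?x - real n * poly (legendre (n - 1)) ?x) / (real n + 1))"
    using Suc.hyps Suc.IH[of n] Suc.IH[of "n - 1"] node by (simp add: exec_append)
  obtain j where n: "n = Suc j"
    using Suc.hyps by (cases n) auto
  have "poly (legendre (Suc n)) ?x =
      ((2 * real n + 1) * ?x * poly (legendre n) ?x - real n * poly (legendre (n - 1)) ?x) / (real n + 1)"
    using legendre_rec_recurrence[of j ?x] by (simp add: n legendre_eq_legendre_rec field_simps)
  then show ?case
    using Suc.IH[of k] Suc.prems unfolding loop by (cases "k = Suc n") auto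
qed

lemma exec_tabulate:
  assumes "n \<ge> 1" and nodes: "\<forall>i\<in>{1..n}. m (Node i) = gl_node n i"
  shows "legendre_table n (exec (tabulate n) m)"
proof -
  let ?I = "\<lambda>m. \<forall>i\<in>{1..n}. m (Node i) = gl_node n i"
  let ?Q = "\<lambda>i m. \<forall>k\<le>n. m (LegAt k i) = poly (legendre k) (gl_node n i)"
  have "?I (exec (tabulate n) m) \<and> (\<forall>i\<in>set [1..<n + 1]. ?Q i (exec (tabulate n) m))"
    unfolding tabulate_def
  proof (rule exec_loop[where I = ?I and Q = ?Q])
    fix i m assume i: "i \<in> set [1..<n + 1]" and I: "?I m"
    let ?init = "[LegAt 0 i ::= Num 1, LegAt 1 i ::= Var (Node i)]"
    let ?loop = "map (\<lambda>k. LegAt (k + 1) i ::=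
      ((Num 2 \<otimes> Num k \<oplus> Num 1) \<otimes> Var (Node i) \<otimes> Var (LegAt k i)
         \<ominus> Num k \<otimes> Var (LegAt (k - 1) i)) \<oslash> (Num k \<oplus> Num 1)) [1..<n]"
    have "exec (?init @ ?loop) m (Node i') = m (Node i')" for i'
      by (rule exec_unchanged) auto
    moreover have "exec ?loop (exec ?init m) (LegAt k i) = poly (legendre k) (exec ?init m (Node i))"
      if "k \<le> n" for k
      using \<open>n \<ge> 1\<close> that by (intro exec_three_term_recurrence) auto
    ultimately show "?I (exec (?init @ ?loop) m) \<and> ?Q i (exec (?init @ ?loop) m)"
      using i I unfolding exec_append by auto
  next
    fix i j m assume "i \<noteq> j" "?Q i m"
    then show "?Q i (exec ([LegAt 0 j ::= Num 1, LegAt 1 j ::= Var (Node j)] @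
      map (\<lambda>k. LegAt (k + 1) j ::=
      ((Num 2 \<otimes> Num k \<oplus> Num 1) \<otimes> Var (Node j) \<otimes> Var (LegAt k j)
         \<ominus> Num k \<otimes> Var (LegAt (k - 1) j)) \<oslash> (Num k \<oplus> Num 1)) [1..<n]) m)"
      by (subst exec_unchanged) auto
  qed (rule nodes)
  then show ?thesis
    by (auto simp: legendre_table_def)
qed

lemma aval_diff_at:
  assumes "legendre_table n m" "i \<in> {1..n}" "k < n"
  shows "aval (diff_at k i) m = poly (legendre_diff k) (gl_node n i)"
  using assms by (auto simp: diff_at_def legendre_diff_def legendre_table_def)

lemma legendre_table_cong:
  assumes "\<And>k i. m' (LegAt k i) = m (LegAt k i)"
  shows "legendre_table n m' \<longleftrightarrow> legendre_table n m"
  using assms by (simp add: legendre_table_def)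

lemma exec_coefs_B:
  assumes "legendre_table n m" "n \<ge> 1" "i \<le> n" "k < n - 1"
  shows "exec (coefs_B n i) m (Coef k) = (2 * real (Suc k) + 1) / (2 * real (Suc k)) *
    (if i = 0 then poly (legendre (Suc k)) (gl_node n 1)
     else if i = n then poly (legendre (Suc k)) (gl_node n n)
     else poly (legendre (Suc k)) (gl_node n i) - poly (legendre (Suc k)) (gl_node n (i + 1)))"
proof -
  let ?v = "\<lambda>k. (2 * real k + 1) / (2 * real k) *
    (if i = 0 then poly (legendre k) (gl_node n 1)
     else if i = n then poly (legendre k) (gl_node n n)
     else poly (legendre k) (gl_node n i) - poly (legendre k) (gl_node n (i + 1)))"
  have "exec (coefs_B n i) m (Coef (Suc k - 1)) = ?v (Suc k)"
    unfolding coefs_B_def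
  proof (rule exec_assign_family[where v = ?v])
    fix k m' assume k: "k \<in> set [1..<n]"
      and "\<And>x. x \<notin> (\<lambda>k. Coef (k - 1)) ` set [1..<n] \<Longrightarrow> m' x = m x"
    then have "legendre_table n m'"
      using assms(1) by (subst legendre_table_cong[of _ m]) auto
    then show "aval ((Num 2 \<otimes> Num k \<oplus> Num 1) \<oslash> (Num 2 \<otimes> Num k) \<otimes>
            (if i = 0 then Var (LegAt k 1)
             else if i = n then Var (LegAt k n)
             else Var (LegAt k i) \<ominus> Var (LegAt k (i + 1)))) m' = ?v k"
      using k assms by (auto simp: legendre_table_def)
  qed (use assms in auto)
  then show ?thesis by simp
qed

lemma exec_coefs_A:
  assumes "legendre_table n m" "n \<ge> 1" "i \<le> n"
  defines "R \<equiv> \<lambda>k i. poly (legendre_diff k) (gl_node n i)"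
    and "P \<equiv> \<lambda>i. poly (legendre (n - 1)) (gl_node n i)"
  shows "k < n \<Longrightarrow> exec (coefs_A n i) m (Coef k) =
      (if i = 0 then 1/2 * R k 1 else if i = n then - (1/2 * R k n)
       else 1/2 * (R k (i + 1) - R k i))"
    and "exec (coefs_A n i) m (Coef n) =
      (if i = 0 then - (1/2 * P 1) else if i = n then 1/2 * P n
       else 1/2 * (P i - P (i + 1)))"
proof -
  \<comment> \<open>Moving the case distinction into the right-hand sides turns the three versions of the code
    into one.\<close>
  define a where "a k = (if i = 0 then half \<otimes> diff_at k 1
     else if i = n then Num 0 \<ominus> half \<otimes> diff_at k n
     else half \<otimes> (diff_at k (i + 1) \<ominus> diff_at k i))" for k
  define b where "b = (if i = 0 then Num 0 \<ominus> half \<otimes> Var (LegAt (n - 1) 1)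
     else if i = n then half \<otimes> Var (LegAt (n - 1) n)
     else half \<otimes> (Var (LegAt (n - 1) i) \<ominus> Var (LegAt (n - 1) (i + 1))))"
  let ?loop = "map (\<lambda>k. Coef k ::= a k) [0..<n]"
  have coefs: "coefs_A n i = ?loop @ [Coef n ::= b]"
    by (simp add: coefs_A_def a_def b_def)
  let ?v = "\<lambda>k. (if i = 0 then 1/2 * R k 1 else if i = n then - (1/2 * R k n)
       else 1/2 * (R k (i + 1) - R k i))"
  have table: "legendre_table n m'" if "\<And>k i. m' (LegAt k i) = m (LegAt k i)" for m'
    using assms(1) that legendre_table_cong[where m = m and m' = m'] by blast
  have "exec ?loop m (Coef k) = ?v k" if "k < n" for k
  proof (rule exec_assign_family[where v = ?v])
    fix k m' assume k: "k \<in> set [0..<n]" and "\<And>x. x \<notin> Coef ` set [0..<n] \<Longrightarrow> m' x = m x"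
    then have "legendre_table n m'"
      by (intro table) auto
    then show "aval (a k) m' = ?v k"
      using k assms(2,3) by (auto simp: a_def half_def R_def aval_diff_at)
  qed (use that in auto)
  then show "exec (coefs_A n i) m (Coef k) = ?v k" if "k < n"
    using that by (simp add: coefs exec_append)
  have "legendre_table n (exec ?loop m)"
    by (intro table exec_unchanged) auto
  then show "exec (coefs_A n i) m (Coef n) =
      (if i = 0 then - (1/2 * P 1) else if i = n then 1/2 * P n
       else 1/2 * (P i - P (i + 1)))"
    using assms(2,3) by (auto simp: coefs exec_append b_def half_def P_def legendre_table_def)
qed

lemma targets_coefs_A: "target ` set (coefs_A n i) \<subseteq> range Coef"
  by (auto simp: coefs_A_def)

lemma targets_coefs_B: "target ` set (coefs_B n i) \<subseteq> range Coef"
  by (auto simp: coefs_B_def)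

lemma targets_clenshaw: "target ` set (clenshaw a N) \<subseteq> range Clen"
  by (auto simp: clenshaw_def)

lemma targets_eval:
  assumes "prog \<in> {eval_A, eval_B}"
  shows "target ` set (prog n) \<subseteq> {LegAt k i |k i. True} \<union> range Coef \<union> range Clen \<union> range FVal"
proof -
  have "target ` set (tabulate n) \<subseteq> {LegAt k i |k i. True}"
    by (auto simp: tabulate_def)
  then show ?thesis
    using assms targets_coefs_A[of n] targets_coefs_B[of n] targets_clenshaw
    unfolding eval_A_def eval_B_def by (auto simp: image_subset_iff) blast+
qed

text \<open>The common structure of both evaluation programs: each output value is computed from the table
  and the argument, and the temporaries \<open>Coef\<close> and \<open>Clen\<close> may be overwritten freely.\<close>

lemma exec_eval_loop:
  assumes "legendre_table n m" "m Param = t"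
    and body: "\<And>i m. i \<le> n \<Longrightarrow> legendre_table n m \<Longrightarrow> m Param = t \<Longrightarrow>
      aval (result i) (exec (clen i) (exec (coefs i) m)) = f i"
    and targets: "\<And>i. target ` set (coefs i) \<subseteq> range Coef" "\<And>i. target ` set (clen i) \<subseteq> range Clen"
    and "i \<le> n"
  shows "exec (concat (map (\<lambda>i. coefs i @ clen i @ [FVal i ::= result i]) [0..<n + 1])) m (FVal i) = f i"
proof -
  let ?body = "\<lambda>i. coefs i @ clen i @ [FVal i ::= result i]"
  let ?I = "\<lambda>m. legendre_table n m \<and> m Param = t"
  have keep: "exec (?body i) m x = m x" if "x \<notin> range Coef" "x \<notin> range Clen" "x \<noteq> FVal i" for i m x
    using that targets[of i] by (intro exec_unchanged) auto
  have "?I (exec (concat (map ?body [0..<n + 1])) m) \<and>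
      (\<forall>i\<in>set [0..<n + 1]. exec (concat (map ?body [0..<n + 1])) m (FVal i) = f i)"
  proof (rule exec_loop[where I = ?I and Q = "\<lambda>i m. m (FVal i) = f i"])
    fix i m assume i: "i \<in> set [0..<n + 1]" and I: "?I m"
    have "legendre_table n (exec (?body i) m)"
      using I by (subst legendre_table_cong[of _ m]) (auto intro!: keep)
    moreover have "exec (?body i) m Param = t"
      using I keep[of Param i m] by auto
    moreover have "exec (?body i) m (FVal i) = f i"
      using body[of i m] i I by (auto simp: exec_append simp del: upt_Suc)
    ultimately show "?I (exec (?body i) m) \<and> exec (?body i) m (FVal i) = f i"
      by blast
  next
    fix i j m assume "i \<noteq> j" "m (FVal i) = f i"
    then show "exec (?body j) m (FVal i) = f i"
      by (subst keep) auto
  qed (use assms in auto)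
  then show ?thesis
    using \<open>i \<le> n\<close> by auto
qed

lemma exec_eval_A:
  assumes "n \<ge> 1" "-1 < t" "m Param = t" "\<forall>i\<in>{1..n}. m (Node i) = gl_node n i" "i \<le> n"
  shows "exec (eval_A n) m (FVal i) = gl_F n i t"
  unfolding eval_A_def exec_append
proof (rule exec_eval_loop[where f = "\<lambda>i. gl_F n i t" and coefs = "coefs_A n"
      and clen = "\<lambda>_. clenshaw (Num 0) (n + 1)" and result = "result_A n", OF exec_tabulate])
  show "exec (tabulate n) m Param = t"
    using assms(3) by (subst exec_unchanged) (auto simp: tabulate_def)
  fix i m assume i: "i \<le> n" and m: "legendre_table n m" "m Param = t"
  let ?R = "\<lambda>k i. poly (legendre_diff k) (gl_node n i)" and ?P = "\<lambda>k. poly (legendre k) t"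
    and ?L = "\<lambda>i. poly (legendre (n - 1)) (gl_node n i)"
  let ?m = "exec (coefs_A n i) m"
  have "?m Param = t"
    using m(2) targets_coefs_A[of n i] by (subst exec_unchanged) auto
  then have "exec (clenshaw (Num 0) (n + 1)) ?m (Clen 0) = (\<Sum>k<n + 1. ?m (Coef k) * ?P k)"
    by (intro exec_clenshaw[where x = t] legendre_clenshaw_recurrence)
      (simp_all add: legendre_eq_legendre_rec)
  also have "\<dots> = (\<Sum>k<n. ?m (Coef k) * ?P k) + ?m (Coef n) * ?P n"
    by simp
  also have "(\<Sum>k<n. ?m (Coef k) * ?P k) =
      (\<Sum>k<n. 1/2 * ((if i = 0 then ?R k 1 else if i = n then - ?R k n
        else ?R k (i + 1) - ?R k i) * ?P k))"
    by (intro sum.cong refl) (auto simp: exec_coefs_A(1)[OF m(1) assms(1) i])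
  finally have clen: "exec (clenshaw (Num 0) (n + 1)) ?m (Clen 0) =
      1/2 * (\<Sum>k<n. (if i = 0 then ?R k 1 else if i = n then - ?R k n
        else ?R k (i + 1) - ?R k i) * ?P k) +
      (if i = 0 then - (1/2 * ?L 1) else if i = n then 1/2 * ?L n
       else 1/2 * (?L i - ?L (i + 1))) * ?P n"
    unfolding exec_coefs_A(2)[OF m(1) assms(1) i] by (simp only: sum_distrib_left)
  show "aval (result_A n i) (exec (clenshaw (Num 0) (n + 1)) ?m) = gl_F n i t"
  proof -
    consider "i = 0" | "i = n" "i \<noteq> 0" | "1 \<le> i" "i \<le> n - 1" "i \<noteq> 0" "i \<noteq> n"
      using i by linarith
    then show ?thesis
    proof cases
      case 1
      then show ?thesis
        using gl_F_legendre_form_first[OF assms(2,1)] clen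
        by (simp add: result_A_def half_def)
    next
      case 2
      then show ?thesis
        using gl_F_legendre_form_last[OF assms(2,1)] clen
        by (simp add: result_A_def half_def sum_negf)
    next
      case 3
      then show ?thesis
        using gl_F_legendre_form_inner[OF assms(2) 3(1,2)] clen
        by (simp add: result_A_def)
    qed
  qed
qed (use assms targets_coefs_A targets_clenshaw in auto)

lemma exec_eval_B:
  assumes "n \<ge> 1" "-1 < t" "m Param = t" "\<forall>i\<in>{1..n}. m (Node i) = gl_node n i" "i \<le> n"
  shows "exec (eval_B n) m (FVal i) = gl_F n i t"
  unfolding eval_B_def exec_append
proof (rule exec_eval_loop[where f = "\<lambda>i. gl_F n i t" and coefs = "coefs_B n"
      and clen = "\<lambda>_. clenshaw (Num 1) (n - 1)" and result = "result_B n", OF exec_tabulate])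
  show "exec (tabulate n) m Param = t"
    using assms(3) by (subst exec_unchanged) (auto simp: tabulate_def)
  fix i m assume i: "i \<le> n" and m: "legendre_table n m" "m Param = t"
  let ?L = "\<lambda>k i. poly (legendre k) (gl_node n i)" and ?J = "\<lambda>k. poly (sym_jacobi 1 k) t"
  let ?c = "\<lambda>k. if i = 0 then ?L k 1 else if i = n then ?L k n else ?L k i - ?L k (i + 1)"
  let ?m = "exec (coefs_B n i) m" and ?m' = "exec (clenshaw (Num 1) (n - 1)) (exec (coefs_B n i) m)"
  have param: "?m Param = t"
    using m(2) targets_coefs_B[of n i] by (subst exec_unchanged) auto
  have param': "?m' Param = t"
    using param targets_clenshaw[of "Num 1" "n - 1"] by (subst exec_unchanged) auto
  have "?m' (Clen 0) = (\<Sum>k<n - 1. ?m (Coef k) * ?J k)"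
    using param by (intro exec_clenshaw[where x = t] jacobi_clenshaw_recurrence)
      (simp_all add: sym_jacobi_1_eq legendre_pderiv_scaled_def pderiv_pCons)
  also have "\<dots> = (\<Sum>k<n - 1. (2 * real (Suc k) + 1) / (2 * real (Suc k)) * ?c (Suc k) * ?J (Suc k - 1))"
    by (intro sum.cong refl) (simp add: exec_coefs_B[OF m(1) assms(1) i])
  also have "\<dots> = (\<Sum>k=1..n-1. (2 * real k + 1) / (2 * real k) * ?c k * ?J (k - 1))"
    by (simp only: One_nat_def sum.atLeast1_atMost_eq)
  finally have clen: "?m' (Clen 0) =
      (\<Sum>k=1..n-1. (2 * real k + 1) / (2 * real k) * ?c k * ?J (k - 1))" .
  show "aval (result_B n i) ?m' = gl_F n i t"
  proof -
    consider "i = 0" | "i = n" "i \<noteq> 0" | "1 \<le> i" "i \<le> n - 1" "i \<noteq> 0" "i \<noteq> n"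
      using i by linarith
    then show ?thesis
    proof cases
      case 1
      then show ?thesis
        using gl_F_jacobi_form_first[OF assms(2,1)] clen param'
        by (simp add: result_B_def end_B_def half_def)
    next
      case 2
      then show ?thesis
        using gl_F_jacobi_form_last[OF assms(2,1)] clen param'
        by (simp add: result_B_def end_B_def half_def)
    next
      case 3
      then show ?thesis
        using gl_F_jacobi_form_inner[OF assms(2) 3(1,2)] clen param'
        by (simp add: result_B_def half_def power2_eq_square)
    qed
  qed
qed (use assms targets_coefs_B targets_clenshaw in auto)

lemma exec_combine:
  assumes "j < d"
  shows "exec (combine n d) m (Point j) = (\<Sum>i=0..n. m (Ctrl i j) * m (FVal i))"
proof -
  let ?inner = "\<lambda>j. map (\<lambda>i. Point j ::= Var (Point j) \<oplus> Var (Ctrl i j) \<otimes> Var (FVal i))"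
  let ?body = "\<lambda>j. (Point j ::= Num 0) # ?inner j [0..<n + 1]"
  let ?I = "\<lambda>m'. (\<forall>i j. m' (Ctrl i j) = m (Ctrl i j)) \<and> (\<forall>i. m' (FVal i) = m (FVal i))"
  have inner: "exec (?inner j xs) m' (Point j) =
      m' (Point j) + sum_list (map (\<lambda>i. m' (Ctrl i j) * m' (FVal i)) xs)" for xs j m'
    by (induction xs arbitrary: m') auto
  have keep: "exec (?body j) m' x = m' x" if "x \<noteq> Point j" for x j m'
    using that by (intro exec_unchanged) auto
  have "?I (exec (combine n d) m) \<and>
      (\<forall>j\<in>set [0..<d]. exec (combine n d) m (Point j) = (\<Sum>i=0..n. m (Ctrl i j) * m (FVal i)))"
    unfolding combine_def
  proof (rule exec_loop[where I = ?I
        and Q = "\<lambda>j m'. m' (Point j) = (\<Sum>i=0..n. m (Ctrl i j) * m (FVal i))"])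
    fix j m' assume I: "?I m'"
    have "exec (?body j) m' (Point j) = sum_list (map (\<lambda>i. m (Ctrl i j) * m (FVal i)) [0..<n + 1])"
      using I by (simp only: exec.simps inner) (simp del: upt_Suc)
    also have "\<dots> = (\<Sum>i=0..n. m (Ctrl i j) * m (FVal i))"
      by (simp add: interv_sum_list_conv_sum_set_nat atLeastLessThanSuc_atLeastAtMost
          del: upt_Suc sum.op_ivl_Suc)
    finally show "?I (exec (?body j) m') \<and>
        exec (?body j) m' (Point j) = (\<Sum>i=0..n. m (Ctrl i j) * m (FVal i))"
      using I keep[of _ j m'] by (simp del: exec.simps)
  next
    fix i j m' assume "i \<noteq> j" "m' (Point i) = (\<Sum>k=0..n. m (Ctrl k i) * m (FVal k))"
    then show "exec (?body j) m' (Point i) = (\<Sum>k=0..n. m (Ctrl k i) * m (FVal k))"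
      by (subst keep) auto
  qed simp
  then show ?thesis
    using assms by auto
qed

section \<open>Operation counts\<close>

lemma cost_concat_map_le:
  assumes "\<And>i. i \<in> set xs \<Longrightarrow> cost (body i) \<le> c"
  shows "cost (concat (map body xs)) \<le> length xs * c"
  using assms
proof (induction xs)
  case (Cons i xs)
  then show ?case
    using add_mono[of "cost (body i)" c "cost (concat (map body xs))" "length xs * c"]
    by (simp add: cost_append)
qed simp

lemma cost_map: "cost (map (\<lambda>k. x k ::= a k) xs) = (\<Sum>k\<leftarrow>xs. ops (a k))"
  by (induction xs) auto

lemma ops_constants: "ops half = 1" "ops (diff_at k i) = 1"
  by (simp_all add: half_def diff_at_def)

lemma cost_tabulate: "cost (tabulate n) \<le> 8 * n * n"
proof -
  have "cost (tabulate n) \<le> length [1..<n + 1] * (8 * n)"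
    unfolding tabulate_def
    by (rule cost_concat_map_le) (simp add: cost_map sum_list_triv del: upt_Suc)
  then show ?thesis by (simp add: algebra_simps del: upt_Suc)
qed

lemma cost_clenshaw: "cost (clenshaw (Num a) N) = 23 * N"
  by (simp add: clenshaw_def cost_map xi1_def xi2_def sum_list_triv)

lemma cost_coefs_A: "cost (coefs_A n i) \<le> 5 * (n + 1)"
  by (simp add: coefs_A_def cost_append cost_map ops_constants sum_list_triv)

lemma cost_coefs_B: "cost (coefs_B n i) \<le> 6 * n"
  by (cases "i = 0"; cases "i = n") (simp_all add: coefs_B_def cost_map sum_list_triv)

lemma cost_eval_A: "cost (eval_A n) \<le> 8 * n * n + (n + 1) * (28 * n + 30)"
proof -
  have "cost (concat (map (\<lambda>i. coefs_A n i @ clenshaw (Num 0) (n + 1) @ [FVal i ::= result_A n i])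
      [0..<n + 1])) \<le> length [0..<n + 1] * (28 * n + 30)"
  proof (rule cost_concat_map_le)
    fix i
    have "ops (result_A n i) \<le> 2"
      by (simp add: result_A_def ops_constants)
    then show "cost (coefs_A n i @ clenshaw (Num 0) (n + 1) @ [FVal i ::= result_A n i]) \<le> 28 * n + 30"
      using cost_coefs_A[of n i] by (simp add: cost_append cost_clenshaw)
  qed
  then show ?thesis
    using cost_tabulate[of n] by (simp add: eval_A_def cost_append)
qed

lemma cost_eval_B: "cost (eval_B n) \<le> 8 * n * n + (n + 1) * (29 * n + 8)"
proof -
  have "cost (concat (map (\<lambda>i. coefs_B n i @ clenshaw (Num 1) (n - 1) @ [FVal i ::= result_B n i])
      [0..<n + 1])) \<le> length [0..<n + 1] * (29 * n + 8)"
  proof (rule cost_concat_map_le)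
    fix i
    have "ops (result_B n i) \<le> 8"
      by (simp add: result_B_def end_B_def ops_constants)
    then show "cost (coefs_B n i @ clenshaw (Num 1) (n - 1) @ [FVal i ::= result_B n i]) \<le> 29 * n + 8"
      using cost_coefs_B[of n i] by (simp add: cost_append cost_clenshaw)
  qed
  then show ?thesis
    using cost_tabulate[of n] by (simp add: eval_B_def cost_append)
qed

lemma cost_eval_le:
  assumes "prog \<in> {eval_A, eval_B}" "n \<ge> 1"
  shows "cost (prog n) \<le> 124 * n\<^sup>2"
proof -
  have n: "1 \<le> n * n" "n \<le> n * n"
    using \<open>n \<ge> 1\<close> by auto
  have "cost (eval_A n) \<le> 36 * (n * n) + 58 * n + 30" "cost (eval_B n) \<le> 37 * (n * n) + 37 * n + 8"
    using cost_eval_A[of n] cost_eval_B[of n] by (simp_all add: algebra_simps)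
  then have "cost (eval_A n) \<le> 124 * (n * n)" "cost (eval_B n) \<le> 124 * (n * n)"
    using n by linarith+
  then show ?thesis
    using assms(1) by (auto simp: power2_eq_square)
qed

lemma cost_combine_le:
  assumes "n \<ge> 1"
  shows "cost (combine n d) \<le> 4 * (d * n)"
proof -
  have "cost (combine n d) \<le> length [0..<d] * (4 * n)"
    unfolding combine_def
    by (rule cost_concat_map_le) (use assms in \<open>simp add: cost_map sum_list_triv del: upt_Suc\<close>)
  then show ?thesis by simp
qed

lemma exec_eval:
  assumes "prog \<in> {eval_A, eval_B}" "n \<ge> 1" "-1 < t" "m Param = t"
    "\<forall>i\<in>{1..n}. m (Node i) = gl_node n i" "i \<le> n"
  shows "exec (prog n) m (FVal i) = gl_F n i t"
  using assms exec_eval_A exec_eval_B by blast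

lemma exec_eval_combine:
  fixes W :: "nat \<Rightarrow> real ^ 'd"
  assumes prog: "prog \<in> {eval_A, eval_B}" "n \<ge> 1" "-1 < t" "m Param = t"
    "\<forall>i\<in>{1..n}. m (Node i) = gl_node n i"
    and ctrl: "\<forall>i\<le>n. m (Ctrl i j) = W i $ c" and "j < d"
  shows "exec (prog n @ combine n d) m (Point j) = gl_curve n W t $ c"
proof -
  have "exec (prog n) m (Ctrl i j) = m (Ctrl i j)" for i
    using targets_eval[OF prog(1), of n] by (intro exec_unchanged) auto
  then show ?thesis
    using exec_eval[OF prog] ctrl \<open>j < d\<close>
    by (simp add: exec_append exec_combine gl_curve_def mult.commute)
qed

theorem corollary4p8:
  shows
   "(\<forall>n t. n \<ge> 1 \<and> -1 < t \<and> t < 1 \<longrightarrow>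
      (\<forall>i. 1 \<le> i \<and> i \<le> n - 1 \<longrightarrow>
         gl_F n i t =
           1/2 * (poly (legendre (n - 1)) (gl_node n i) - poly (legendre (n - 1)) (gl_node n (i + 1)))
               * poly (legendre n) t
           + 1/2 * (\<Sum>k<n. (poly (legendre_diff k) (gl_node n (i + 1))
                              - poly (legendre_diff k) (gl_node n i)) * poly (legendre k) t)) \<and>
      gl_F n 0 t =
        1/2 - 1/2 * poly (legendre (n - 1)) (gl_node n 1) * poly (legendre n) t
        + 1/2 * (\<Sum>k<n. poly (legendre_diff k) (gl_node n 1) * poly (legendre k) t) \<and>
      gl_F n n t =
        1/2 + 1/2 * poly (legendre (n - 1)) (gl_node n n) * poly (legendre n) t
        - 1/2 * (\<Sum>k<n. poly (legendre_diff k) (gl_node n n) * poly (legendre k) t)) \<and>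

    (\<forall>n t. n \<ge> 1 \<and> -1 < t \<and> t < 1 \<longrightarrow>
      (\<forall>i. 1 \<le> i \<and> i \<le> n - 1 \<longrightarrow>
         gl_F n i t =
           1/2 * (t\<^sup>2 - 1) * (\<Sum>k=1..n-1. (2 * real k + 1) / (2 * real k)
               * (poly (legendre k) (gl_node n i) - poly (legendre k) (gl_node n (i + 1)))
               * poly (sym_jacobi 1 (k - 1)) t)) \<and>
      gl_F n 0 t =
        1 - 1/2 * (t + 1) * (1 + (t - 1) * (\<Sum>k=1..n-1. (2 * real k + 1) / (2 * real k)
               * poly (legendre k) (gl_node n 1) * poly (sym_jacobi 1 (k - 1)) t)) \<and>
      gl_F n n t =
        1/2 * (t + 1) * (1 + (t - 1) * (\<Sum>k=1..n-1. (2 * real k + 1) / (2 * real k)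
               * poly (legendre k) (gl_node n n) * poly (sym_jacobi 1 (k - 1)) t))) \<and>

    (\<forall>prog\<in>{eval_A, eval_B}. \<forall>n t m. n \<ge> 1 \<and> -1 < t \<and> t < 1 \<and>
       m Param = t \<and> (\<forall>i\<in>{1..n}. m (Node i) = gl_node n i) \<longrightarrow>
       (\<forall>i\<le>n. exec (prog n) m (FVal i) = gl_F n i t)) \<and>

    (\<forall>prog\<in>{eval_A, eval_B}. \<exists>C. \<forall>n\<ge>1. real (cost (prog n)) \<le> C * (real n)\<^sup>2) \<and>

    (\<forall>prog\<in>{eval_A, eval_B}. \<forall>n t m (W :: nat \<Rightarrow> real ^ 'd) e.
       n \<ge> 1 \<and> -1 < t \<and> t < 1 \<and> bij_betw e {..<CARD('d)} (UNIV :: 'd set) \<and>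
       m Param = t \<and> (\<forall>i\<in>{1..n}. m (Node i) = gl_node n i) \<and>
       (\<forall>i\<le>n. \<forall>j<CARD('d). m (Ctrl i j) = W i $ e j) \<longrightarrow>
       (\<forall>j<CARD('d). exec (prog n @ combine n CARD('d)) m (Point j) = gl_curve n W t $ e j)) \<and>

    (\<forall>prog\<in>{eval_A, eval_B}. \<exists>C. \<forall>n\<ge>1. \<forall>d\<ge>1.
       real (cost (prog n @ combine n d)) \<le> C * ((real n)\<^sup>2 + real d * real n))"
proof (intro conjI)
  show "\<forall>prog\<in>{eval_A, eval_B}. \<exists>C. \<forall>n\<ge>1. real (cost (prog n)) \<le> C * (real n)\<^sup>2"
  proof (intro ballI exI allI impI)
    fix prog n assume "prog \<in> {eval_A, eval_B}" "n \<ge> (1::nat)"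
    then have "real (cost (prog n)) \<le> real (124 * n\<^sup>2)"
      by (intro of_nat_mono cost_eval_le)
    then show "real (cost (prog n)) \<le> 124 * (real n)\<^sup>2" by simp
  qed
  show "\<forall>prog\<in>{eval_A, eval_B}. \<exists>C. \<forall>n\<ge>1. \<forall>d\<ge>1.
      real (cost (prog n @ combine n d)) \<le> C * ((real n)\<^sup>2 + real d * real n)"
  proof (intro ballI exI allI impI)
    fix prog n d assume "prog \<in> {eval_A, eval_B}" "n \<ge> (1::nat)"
    then have "cost (prog n @ combine n d) \<le> 124 * n\<^sup>2 + 4 * (d * n)"
      unfolding cost_append by (intro add_mono cost_eval_le cost_combine_le)
    also have "\<dots> \<le> 124 * (n\<^sup>2 + d * n)"
      by simp
    finally have "real (cost (prog n @ combine n d)) \<le> real (124 * (n\<^sup>2 + d * n))"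
      by (rule of_nat_mono)
    then show "real (cost (prog n @ combine n d)) \<le> 124 * ((real n)\<^sup>2 + real d * real n)"
      by simp
  qed
next
  show "\<forall>prog\<in>{eval_A, eval_B}. \<forall>n t m (W :: nat \<Rightarrow> real ^ 'd) e.
       n \<ge> 1 \<and> -1 < t \<and> t < 1 \<and> bij_betw e {..<CARD('d)} (UNIV :: 'd set) \<and>
       m Param = t \<and> (\<forall>i\<in>{1..n}. m (Node i) = gl_node n i) \<and>
       (\<forall>i\<le>n. \<forall>j<CARD('d). m (Ctrl i j) = W i $ e j) \<longrightarrow>
       (\<forall>j<CARD('d). exec (prog n @ combine n CARD('d)) m (Point j) = gl_curve n W t $ e j)"
    by (intro ballI allI impI, elim conjE, rule exec_eval_combine) auto
next
  show "\<forall>prog\<in>{eval_A, eval_B}. \<forall>n t m. n \<ge> 1 \<and> -1 < t \<and> t < 1 \<and>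
       m Param = t \<and> (\<forall>i\<in>{1..n}. m (Node i) = gl_node n i) \<longrightarrow>
       (\<forall>i\<le>n. exec (prog n) m (FVal i) = gl_F n i t)"
    by (intro ballI allI impI, elim conjE, rule exec_eval)
qed (intro allI impI conjI; elim conjE;
  rule gl_F_legendre_form_inner gl_F_legendre_form_first gl_F_legendre_form_last
    gl_F_jacobi_form_inner gl_F_jacobi_form_first gl_F_jacobi_form_last; assumption)+

end
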